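(* Let $\mathcal E_{r,\rho}$ be the trajectory of a symmetrical configuration $\eta_{r,\rho}$ of the second kind, with spectral parameter $r=\frac mn\in(-2,-1/2)$, $m,n\in\mathbb Z$, $\gcd(m,n)=1$, $m<0$ (so $n>0$), and Clifford parameter $\rho\in(0,\sqrt2)$. Then: (1) $\mathcal E_{r,\rho}$ has spin $1/3$ and phase anomaly $4\pi/3$ if and only if there exist $h,k\in\mathbb Z$, $h<0$, $k>0$, such that $m=1+3h$ and $n=1+3k$; (2) $\mathcal E_{r,\rho}$ has spin $1/3$ and phase anomaly $2\pi/3$ if and only if there exist $h,k\in\mathbb Z$, $h<0$, $k>0$, such that $m=2+3h$ and $n=2+3k$.
   Context: $\mathbb C^{2,1}$ is $\mathbb C^3$ with the Hermitian form $\langle \mathbf z,\mathbf w\rangle={}^t\overline{\mathbf z}\,\mathbf h\,\mathbf w$, $\mathbf h=\begin{pmatrix}0&0&i\\0&1&0\\-i&0&0\end{pmatrix}$. $\mathcal N$ is the set of nonzero null vectors, $\mathcal S=\{[\mathbf z]\in\mathbb{CP}^2:\langle\mathbf z,\mathbf z\rangle=0\}$. A lift of a smooth curve $\gamma:\mathbb R\to\mathcal S$ is a smooth $\Gamma:\mathbb R\to\mathcal N$ with $\gamma=[\Gamma]$. $\gamma$ is (positively parametrized) transversal if $-i\langle\Gamma,\Gamma'\rangle>0$, and generic if $\det(\Gamma,\Gamma',\Gamma'')$ never vanishes. A Wilczynski lift has $\det(\Gamma,\Gamma',\Gamma'')=-1$ (unique up to cube roots of unity); the parametrization is natural if moreover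 $i\langle\Gamma,\Gamma'\rangle^{-1}=1$. Phase anomaly and spin. A generic transversal knot $\mathcal K$ is the image of a periodic generic transversal curve that is injective on $[0,\omega)$, $\omega$ the minimal period. Let $\gamma:\mathbb R\to\mathcal S$ be a natural parametrization of $\mathcal K$ with minimal period $\omega$ and $\Gamma$ a Wilczynski lift. Then $\Gamma(\omega)=\varepsilon_\gamma\Gamma(0)$ with $\varepsilon_\gamma$ a cube root of unity independent of $\Gamma$. The phase anomaly of $\mathcal K$ is the argument of $\varepsilon_\gamma$ in $[0,2\pi)$. The (CR) spin of $\mathcal K$ is $1/3$ if $\varepsilon_\gamma\neq1$ and $1$ if $\varepsilon_\gamma=1$. Symmetrical configurations of the second kind. For $(r,\rho)\in(-2,-\frac12)\times(0,\sqrt2)$ let $$\mu_2(r,\rho)=\frac{-4+4r-12\rho^2(1+r)+(r-1)\rho^4}{-4+4r-12\rho^2(1+r)+(r-1)\rho^4-2\big((2+3r-3r^2-2r^3)(-4\rho+\rho^5)\big)^{2/3}}\in(0,1),$$ $e_2^1=r\frac{\mu_2}{1-\mu_2}$, $e_2^2=-(1+r)\frac{\mu_2}{1-\mu_2}$, $e_2^3=\frac{\mu_2}{1-\mu_2}$, $D_2(r,\rho)=\mathrm{diag}(-ie_2^3,-ie_2^2,-ie_2^1)$, $\mathcal U=\begin{pmatrix}\frac1{\sqrt2}&0&\frac i{\sqrt2}\\0&1&0\\\frac i{\sqrt2}&0&\frac1{\sqrt2}\end{pmatrix}$, $S(\rho)=[{}^t(1,\rho,i\rho^2/2)]\in\mathcal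 S$. For $r\in\mathbb Q$, the symmetrical configuration of the second kind with spectral parameter $r$ and Clifford parameter $\rho$ is $\eta_{r,\rho}(s)=\big(\mathcal U\exp(sD_2(r,\rho))\,\mathcal U^{-1}\big)S(\rho)$; it is a natural parametrization of a generic transversal knot $\mathcal E_{r,\rho}$ (its trajectory). *)

theory Defs
  imports "HOL-Analysis.Analysis"
begin

definition hmat :: "complex^3^3" where
  "hmat = vector [vector [0, 0, \<i>], vector [0, 1, 0], vector [-\<i>, 0, 0]]"

definition hform :: "complex^3 \<Rightarrow> complex^3 \<Rightarrow> complex" where
  "hform z w = (\<Sum>i\<in>UNIV. \<Sum>j\<in>UNIV. cnj (z $ i) * hmat $ i $ j * w $ j)"

definition null_vectors :: "(complex^3) set" where
  "null_vectors = {z. z \<noteq> 0 \<and> hform z z = 0}"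

text \<open>A point of the projective plane is a one-dimensional linear subspace of the
  three-dimensional space; \<open>pt z\<close> is the class of a nonzero vector \<open>z\<close>.
  The sphere is the set of points \<open>pt z\<close> with \<open>z \<in> null_vectors\<close>.\<close>

definition pt :: "complex^3 \<Rightarrow> (complex^3) set" where
  "pt z = {c *s z | c. True}"

definition proj_map :: "complex^3^3 \<Rightarrow> (complex^3) set \<Rightarrow> (complex^3) set" where
  "proj_map A L = (\<lambda>z. A *v z) ` L"

definition vderiv :: "(real \<Rightarrow> 'a::real_normed_vector) \<Rightarrow> real \<Rightarrow> 'a" where
  "vderiv f = (\<lambda>t. vector_derivative f (at t))"

definition smooth :: "(real \<Rightarrow> 'a::real_normed_vector) \<Rightarrow> bool" where
  "smooth f \<longleftrightarrow> (\<forall>k t. (vderiv ^^ k) f differentiable (at t))"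

definition det3 :: "complex^3 \<Rightarrow> complex^3 \<Rightarrow> complex^3 \<Rightarrow> complex" where
  "det3 u v w = det (transpose (vector [u, v, w] :: complex^3^3))"

definition is_lift :: "(real \<Rightarrow> complex^3) \<Rightarrow> (real \<Rightarrow> (complex^3) set) \<Rightarrow> bool" where
  "is_lift \<Gamma> \<gamma> \<longleftrightarrow> smooth \<Gamma> \<and> (\<forall>s. \<Gamma> s \<in> null_vectors \<and> \<gamma> s = pt (\<Gamma> s))"

text \<open>A curve of the sphere is smooth iff it has a (global, smooth) lift, so smoothness of the curve is
  contained in the next two predicates; neither depends on the choice of the lift. The
  condition on the imaginary part spells out that the inequality is one between real numbers
  (it holds for every lift, because the lift is a null curve).\<close>

definition transversal :: "(real \<Rightarrow> (complex^3) set) \<Rightarrow> bool" where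
  "transversal \<gamma> \<longleftrightarrow> (\<exists>\<Gamma>. is_lift \<Gamma> \<gamma> \<and>
     (\<forall>s. Im (-\<i> * hform (\<Gamma> s) (vderiv \<Gamma> s)) = 0 \<and> Re (-\<i> * hform (\<Gamma> s) (vderiv \<Gamma> s)) > 0))"

definition generic :: "(real \<Rightarrow> (complex^3) set) \<Rightarrow> bool" where
  "generic \<gamma> \<longleftrightarrow> (\<exists>\<Gamma>. is_lift \<Gamma> \<gamma> \<and>
     (\<forall>s. det3 (\<Gamma> s) (vderiv \<Gamma> s) (vderiv (vderiv \<Gamma>) s) \<noteq> 0))"

definition Wilczynski_lift :: "(real \<Rightarrow> complex^3) \<Rightarrow> (real \<Rightarrow> (complex^3) set) \<Rightarrow> bool" where
  "Wilczynski_lift \<Gamma> \<gamma> \<longleftrightarrow> is_lift \<Gamma> \<gamma> \<and>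
     (\<forall>s. det3 (\<Gamma> s) (vderiv \<Gamma> s) (vderiv (vderiv \<Gamma>) s) = -1)"

definition natural_curve :: "(real \<Rightarrow> (complex^3) set) \<Rightarrow> bool" where
  "natural_curve \<gamma> \<longleftrightarrow> (\<exists>\<Gamma>. Wilczynski_lift \<Gamma> \<gamma> \<and>
     (\<forall>s. \<i> * inverse (hform (\<Gamma> s) (vderiv \<Gamma> s)) = 1))"

definition minimal_period :: "(real \<Rightarrow> 'a) \<Rightarrow> real \<Rightarrow> bool" where
  "minimal_period \<gamma> \<omega> \<longleftrightarrow> \<omega> > 0 \<and> (\<forall>s. \<gamma> (s + \<omega>) = \<gamma> s) \<and>
     (\<forall>p>0. (\<forall>s. \<gamma> (s + p) = \<gamma> s) \<longrightarrow> \<omega> \<le> p)"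

definition knot_parametrization ::
  "(real \<Rightarrow> (complex^3) set) \<Rightarrow> real \<Rightarrow> (complex^3) set set \<Rightarrow> bool" where
  "knot_parametrization \<gamma> \<omega> K \<longleftrightarrow> transversal \<gamma> \<and> generic \<gamma> \<and>
     minimal_period \<gamma> \<omega> \<and> inj_on \<gamma> {0..<\<omega>} \<and> range \<gamma> = K"

definition natural_parametrization ::
  "(real \<Rightarrow> (complex^3) set) \<Rightarrow> real \<Rightarrow> (complex^3) set set \<Rightarrow> bool" where
  "natural_parametrization \<gamma> \<omega> K \<longleftrightarrow> knot_parametrization \<gamma> \<omega> K \<and> natural_curve \<gamma>"

text \<open>The factor below is the same for all natural parametrizations of a given generic
  transversal knot and all their Wilczynski lifts.\<close>

definition monodromy :: "(complex^3) set set \<Rightarrow> complex" where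
  "monodromy K = (THE \<epsilon>. \<exists>\<gamma> \<omega> \<Gamma>. natural_parametrization \<gamma> \<omega> K \<and>
     Wilczynski_lift \<Gamma> \<gamma> \<and> \<Gamma> \<omega> = \<epsilon> *s \<Gamma> 0)"

definition phase_anomaly :: "(complex^3) set set \<Rightarrow> real" where
  "phase_anomaly K = Arg2pi (monodromy K)"

definition CR_spin :: "(complex^3) set set \<Rightarrow> real" where
  "CR_spin K = (if monodromy K = 1 then 1 else 1/3)"

definition mat_exp :: "complex^'n^'n \<Rightarrow> complex^'n^'n" where
  "mat_exp A = (\<Sum>k. (1 / fact k) *\<^sub>R ((\<lambda>B. A ** B) ^^ k) (mat 1))"

text \<open>For \<open>-2 < r < -1/2\<close> and \<open>0 < \<rho> < sqrt 2\<close> the base of the power with exponent \<open>2/3\<close> is positive,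
  which is the range where \<open>powr\<close> is the usual real power.\<close>

definition mu2 :: "real \<Rightarrow> real \<Rightarrow> real" where
  "mu2 r \<rho> =
     (-4 + 4*r - 12*\<rho>^2*(1 + r) + (r - 1)*\<rho>^4) /
     (-4 + 4*r - 12*\<rho>^2*(1 + r) + (r - 1)*\<rho>^4
        - 2 * ((2 + 3*r - 3*r^2 - 2*r^3) * (-4*\<rho> + \<rho>^5)) powr (2/3))"

definition e21 :: "real \<Rightarrow> real \<Rightarrow> real" where
  "e21 r \<rho> = r * (mu2 r \<rho> / (1 - mu2 r \<rho>))"

definition e22 :: "real \<Rightarrow> real \<Rightarrow> real" where
  "e22 r \<rho> = - (1 + r) * (mu2 r \<rho> / (1 - mu2 r \<rho>))"

definition e23 :: "real \<Rightarrow> real \<Rightarrow> real" where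
  "e23 r \<rho> = mu2 r \<rho> / (1 - mu2 r \<rho>)"

definition D2 :: "real \<Rightarrow> real \<Rightarrow> complex^3^3" where
  "D2 r \<rho> = vector
     [vector [-\<i> * of_real (e23 r \<rho>), 0, 0],
      vector [0, -\<i> * of_real (e22 r \<rho>), 0],
      vector [0, 0, -\<i> * of_real (e21 r \<rho>)]]"

definition Umat :: "complex^3^3" where
  "Umat = vector
     [vector [1 / of_real (sqrt 2), 0, \<i> / of_real (sqrt 2)],
      vector [0, 1, 0],
      vector [\<i> / of_real (sqrt 2), 0, 1 / of_real (sqrt 2)]]"

definition Spt :: "real \<Rightarrow> (complex^3) set" where
  "Spt \<rho> = pt (vector [1, of_real \<rho>, \<i> * of_real (\<rho>^2) / 2])"

definition config2 :: "real \<Rightarrow> real \<Rightarrow> real \<Rightarrow> (complex^3) set" where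
  "config2 r \<rho> s = proj_map (Umat ** mat_exp (s *\<^sub>R D2 r \<rho>) ** matrix_inv Umat) (Spt \<rho>)"

definition trajectory2 :: "real \<Rightarrow> real \<Rightarrow> (complex^3) set set" where
  "trajectory2 r \<rho> = range (config2 r \<rho>)"

end

theory Submission
  imports Defs
begin

text \<open>In the eigenbasis of the one-parameter group the configuration is
  \<open>(a exp(-i f\<^sub>1 s), b exp(-i f\<^sub>2 s), -i c exp(-i f\<^sub>3 s))\<close>, and rationality of \<open>r\<close> makes
  \<open>f\<^sub>1 - f\<^sub>2 = \<kappa> P\<close> and \<open>f\<^sub>1 - f\<^sub>3 = \<kappa> R\<close> with coprime \<open>P\<close> and \<open>R\<close>, so that the minimal period is
  \<open>2 \<pi> / \<kappa>\<close> and the monodromy is \<open>exp(-i f\<^sub>1 2 \<pi> / \<kappa>) = exp(-2 \<pi> i (P + R) / 3)\<close>.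

  The monodromy must not depend on the natural parametrization of the knot. Any curve inside the
  knot satisfies the torus relation \<open>x\<^sub>2\<^sup>R x\<^sub>1\<^sup>P = x\<^sub>3\<^sup>P x\<^sub>1\<^sup>R\<close> and \<open>|x\<^sub>1| = |x\<^sub>2| = |x\<^sub>3|\<close> between its
  normalised coordinates. Taking logarithmic derivatives, the differences of the \<open>x\<^sub>j' / x\<^sub>j\<close> are
  those of the model orbit multiplied by a real speed \<open>\<psi>\<close>. The two normalisations then read
  \<open>rot \<psi>\<^sup>3 x\<^sub>1 x\<^sub>2 x\<^sub>3 = 1\<close> and \<open>drift \<psi> |x\<^sub>1|\<^sup>2 = 1\<close>; the choice of \<open>\<mu>\<^sub>2\<close> means
  \<open>drift\<^sup>3 = rot\<^sup>2\<close>, whence \<open>\<psi> = 1\<close> and the curve is the orbit up to a shift of the parameter.\<close>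

section \<open>Linear algebra and logarithmic derivatives\<close>

lemma det_Umat: "det Umat = 1"
  unfolding Umat_def det_3
  by (simp add: divide_simps flip: of_real_mult)

text \<open>The columns of \<open>Umat\<close> are orthogonal for the form, with squares -1, 1, 1,
  so the eigenbasis of the one-parameter group also diagonalises the form.\<close>

lemma hform_Umat:
  "hform (Umat *v z) (Umat *v w) = - cnj (z $ 1) * w $ 1 + cnj (z $ 2) * w $ 2 + cnj (z $ 3) * w $ 3"
proof -
  define h where "h = 1 / complex_of_real (sqrt 2)"
  have h: "h * h = 1 / 2" "cnj h = h"
    by (simp_all add: h_def flip: of_real_mult)
  have U: "Umat = vector [vector [h, 0, \<i> * h], vector [0, 1, 0], vector [\<i> * h, 0, h]]"
    by (simp add: Umat_def h_def)
  have "hform (Umat *v z) (Umat *v w) = - (2 * (h * h)) * cnj (z $ 1) * w $ 1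
      + cnj (z $ 2) * w $ 2 + 2 * (h * h) * cnj (z $ 3) * w $ 3"
    unfolding hform_def U hmat_def matrix_vector_mult_def sum_3
    by (simp add: h(2)) (simp add: algebra_simps)
  then show ?thesis
    by (simp add: h)
qed

lemma det3_mult: "det3 (A *v u) (A *v v) (A *v w) = det A * det3 u v w"
proof -
  have "transpose (vector [A *v u, A *v v, A *v w]) = A ** transpose (vector [u, v, w] :: complex^3^3)"
    by (simp add: vec_eq_iff forall_3 transpose_def matrix_matrix_mult_def matrix_vector_mult_def)
  then show ?thesis
    by (simp add: det3_def det_mul)
qed

lemma det3_expand:
  "det3 u v w = u$1 * (v$2 * w$3 - v$3 * w$2) - u$2 * (v$1 * w$3 - v$3 * w$1) + u$3 * (v$1 * w$2 - v$2 * w$1)"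
  unfolding det3_def det_3 transpose_def by (simp add: algebra_simps)

text \<open>Powers of a diagonal matrix are diagonal, so the series converges entry by entry to
  scalar exponential series.\<close>

lemma mat_exp_diag:
  fixes d :: "complex^'n"
  defines "D \<equiv> (\<chi> i j. if i = j then d $ i else 0)"
  shows "mat_exp D = (\<chi> i j. if i = j then exp (d $ i) else 0)"
proof -
  have pow: "((\<lambda>B. D ** B) ^^ k) (mat 1) = (\<chi> i j. if i = j then (d $ i) ^ k else 0)" for k
  proof (induction k)
    case 0
    show ?case by (simp add: mat_def vec_eq_iff)
  next
    case (Suc k)
    have "(\<Sum>l\<in>UNIV. (if i = l then d $ i else 0) * (if l = j then d $ l ^ k else 0))
        = (if i = j then d $ i * d $ i ^ k else 0)" for i j
      by (subst sum.remove[of _ i]) (auto intro!: sum.neutral)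
    with Suc show ?case
      by (simp add: vec_eq_iff matrix_matrix_mult_def D_def)
  qed
  have "(\<lambda>k. (1 / fact k) *\<^sub>R ((\<lambda>B. D ** B) ^^ k) (mat 1)) sums (\<chi> i j. if i = j then exp (d $ i) else 0)"
    unfolding sums_def pow
  proof (intro vec_tendstoI)
    fix i j
    show "(\<lambda>n. (\<Sum>k<n. (1 / fact k) *\<^sub>R (\<chi> i j. if i = j then d $ i ^ k else 0)) $ i $ j)
           \<longlonglongrightarrow> (\<chi> i j. if i = j then exp (d $ i) else 0) $ i $ j"
      using exp_converges[of "d $ i"]
      by (cases "i = j") (simp_all add: sums_def inverse_eq_divide)
  qed
  then show ?thesis
    by (simp add: mat_exp_def sums_iff)
qed

lemma inv_Umat: "matrix_inv Umat *v (Umat *v z) = z" "Umat *v (matrix_inv Umat *v z) = z"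
proof -
  have "invertible Umat"
    by (simp add: invertible_det_nz det_Umat)
  then have "matrix_inv Umat ** Umat = mat 1" "Umat ** matrix_inv Umat = mat 1"
    by (simp_all add: matrix_inv_def invertible_def someI_ex[where P = "\<lambda>A'. Umat ** A' = mat 1 \<and> A' ** Umat = mat 1"])
  then show "matrix_inv Umat *v (Umat *v z) = z" "Umat *v (matrix_inv Umat *v z) = z"
    by (simp_all add: matrix_vector_mul_assoc)
qed

lemma pt_eq_iff:
  assumes "u \<noteq> 0" "v \<noteq> 0"
  shows "pt u = pt v \<longleftrightarrow> (\<exists>c. c \<noteq> 0 \<and> u = c *s v)"
proof
  assume "pt u = pt v"
  moreover have "u \<in> pt u"
    unfolding pt_def by (metis (mono_tags, lifting) mem_Collect_eq vector_smult_lid)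
  ultimately obtain c where "u = c *s v"
    by (auto simp: pt_def)
  with assms show "\<exists>c. c \<noteq> 0 \<and> u = c *s v"
    by auto
next
  assume "\<exists>c. c \<noteq> 0 \<and> u = c *s v"
  then obtain c where c: "c \<noteq> 0" "u = c *s v"
    by blast
  show "pt u = pt v"
    unfolding pt_def
  proof (safe, goal_cases)
    case (1 _ d)
    show ?case using c by (auto simp: vector_smult_assoc)
  next
    case (2 _ d)
    have "d *s v = (d / c) *s u"
      using c by (simp add: vector_smult_assoc)
    then show ?case by auto
  qed
qed

section \<open>Calculus of logarithmic derivatives\<close>

lemma logderiv_mult:
  fixes f g :: "real \<Rightarrow> complex"
  assumes "(f has_vector_derivative l * f s) (at s)" "(g has_vector_derivative k * g s) (at s)"
  shows "((\<lambda>s. f s * g s) has_vector_derivative (l + k) * (f s * g s)) (at s)"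
  by (rule has_vector_derivative_eq_rhs[OF has_vector_derivative_mult[OF assms]])
    (simp add: algebra_simps)

lemma logderiv_power:
  fixes f :: "real \<Rightarrow> complex"
  assumes "(f has_vector_derivative l * f s) (at s)"
  shows "((\<lambda>s. f s ^ n) has_vector_derivative (of_nat n * l) * f s ^ n) (at s)"
proof (induction n)
  case (Suc n)
  then show ?case
    using logderiv_mult[OF assms Suc] by (simp add: algebra_simps)
qed simp

text \<open>Turns a multiplicative identity between functions into a linear identity between their
  rates, once products and powers have been differentiated.\<close>

lemma logderiv_unique:
  fixes f g :: "real \<Rightarrow> complex"
  assumes "(f has_vector_derivative l * f s) (at s)" "(g has_vector_derivative k * g s) (at s)"
    and "\<And>s. f s = g s" "f s \<noteq> 0"
  shows "l = k"
proof -
  have "f = g"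
    using assms(3) by blast
  with assms(1,2) have "l * f s = k * f s"
    using vector_derivative_unique_at by blast
  with assms(4) show ?thesis by simp
qed

lemma logderiv_exp:
  fixes l :: complex
  shows "((\<lambda>s. exp (l * of_real s)) has_vector_derivative l * exp (l * of_real s)) (at s)"
proof -
  have "((\<lambda>s. exp (s *\<^sub>R l)) has_vector_derivative l * exp (s *\<^sub>R l)) (at s)"
    by (rule exp_scaleR_has_vector_derivative_left)
  then show ?thesis
    by (simp add: scaleR_conv_of_real mult.commute)
qed

lemma logderiv_const:
  fixes f :: "real \<Rightarrow> complex"
  assumes "\<And>s. (f has_vector_derivative l * f s) (at s)"
  shows "f s = f 0 * exp (l * s)"
proof -
  \<comment> \<open>The integrating factor has rate \<open>- l\<close>, which cancels the rate of
    \<open>f\<close>.\<close>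
  have "((\<lambda>s. f s * exp (- l * s)) has_vector_derivative 0) (at s)" for s
    using logderiv_mult[OF assms logderiv_exp[of "- l"]] by simp
  then obtain k where "\<And>s. f s * exp (- l * s) = k"
    using has_vector_derivative_zero_constant[of UNIV "\<lambda>s. f s * exp (- l * s)"] by auto
  from this[of s] this[of 0] have "f s * exp (- l * s) = f 0"
    by simp
  then have "f s * exp (- l * s) * exp (l * s) = f 0 * exp (l * s)"
    by simp
  then show ?thesis
    by (simp add: mult.assoc flip: exp_add)
qed

lemma smooth_has_vector_derivative:
  assumes "smooth f"
  shows "(f has_vector_derivative vderiv f s) (at s)"
    and "(vderiv f has_vector_derivative vderiv (vderiv f) s) (at s)"
proof -
  have "f differentiable at s" "vderiv f differentiable at s"
    using assms[unfolded smooth_def, rule_format, of 0] assms[unfolded smooth_def, rule_format, of 1] by simp_all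
  then show "(f has_vector_derivative vderiv f s) (at s)"
    "(vderiv f has_vector_derivative vderiv (vderiv f) s) (at s)"
    by (auto simp: vderiv_def vector_derivative_works)
qed

section \<open>Curves inside a knotted orbit\<close>

text \<open>The data of an orbit in the eigenbasis: \<open>a\<close>, \<open>b\<close>,
  \<open>c\<close> are the moduli of the coordinates of the base point, and
  \<open>\<kappa> * P\<close>, \<open>\<kappa> * R\<close> are the gaps between the first frequency
  and the other two. Coprimality makes \<open>2 * pi / \<kappa>\<close> the minimal period;
  \<open>natural\<close> makes the two normalisations compatible at unit speed.\<close>

locale clifford_orbit =
  fixes a b c \<kappa> :: real and P R :: nat
  assumes pos: "0 < a" "0 < b" "0 < c" "0 < \<kappa>" "0 < P" "P < R"
    and null: "a^2 = b^2 + c^2"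
    and coprime: "coprime P R"
    and natural: "(\<kappa> * (b^2 * P + c^2 * R)) ^ 3 = (a * b * c * \<kappa>^3 * P * R * (real R - real P))^2"
begin

definition amp :: "complex^3" where
  "amp = vector [of_real a, of_real b, - \<i> * of_real c]"

text \<open>The unique frequencies with gaps \<open>\<kappa> * P\<close> and
  \<open>\<kappa> * R\<close> and with sum zero. The zero sum keeps the product of the three
  coordinates of the orbit constant.\<close>

definition freq :: "real^3" where
  "freq = vector [\<kappa> * (real P + R) / 3, \<kappa> * (real R - 2 * P) / 3, \<kappa> * (real P - 2 * R) / 3]"

definition orbit :: "real \<Rightarrow> complex^3" where
  "orbit s = Umat *v (\<chi> j. amp $ j * exp (- \<i> * freq $ j * s))"

text \<open>Dividing by \<open>amp\<close> places the coordinates of the orbit on the unit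
  circle.\<close>

definition coord :: "complex^3 \<Rightarrow> 3 \<Rightarrow> complex" where
  "coord v j = (matrix_inv Umat *v v) $ j / amp $ j"

text \<open>At unit speed the Wronskian determinant of \<open>orbit\<close> is \<open>- rot\<close>, and
  \<open>hform orbit orbit' = \<i> drift\<close>.\<close>

definition rot :: real where
  "rot = a * b * c * \<kappa>^3 * P * R * (real R - real P)"

definition drift :: real where
  "drift = \<kappa> * (b^2 * P + c^2 * R)"

lemma rot_drift: "drift ^ 3 = rot ^ 2"
  using natural by (simp add: rot_def drift_def)

lemma rot_pos: "0 < rot" and drift_pos: "0 < drift"
  using pos by (auto simp: rot_def drift_def intro!: mult_pos_pos add_pos_pos)

lemma amp_simps [simp]: "amp $ 1 = of_real a" "amp $ 2 = of_real b" "amp $ 3 = - \<i> * of_real c"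
  by (simp_all add: amp_def)

lemma freq_simps: "freq $ 1 = \<kappa> * (real P + R) / 3" "freq $ 2 = \<kappa> * (real R - 2 * P) / 3"
  "freq $ 3 = \<kappa> * (real P - 2 * R) / 3"
  by (simp_all add: freq_def)

lemma amp_nonzero [simp]: "amp $ j \<noteq> 0"
  using exhaust_3[of j] pos by auto

lemma coord_Umat [simp]: "coord (Umat *v (\<chi> j. amp $ j * w j)) j = w j"
  by (simp add: coord_def inv_Umat)

lemma coord_inverse: "Umat *v (\<chi> j. amp $ j * coord v j) = v"
proof -
  have "(\<chi> j. amp $ j * coord v j) = matrix_inv Umat *v v"
    by (simp add: coord_def vec_eq_iff)
  then show ?thesis
    by (simp add: inv_Umat)
qed

lemma coord_eqI:
  assumes "\<And>j. coord u j = coord v j"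
  shows "u = v"
proof -
  have "u = Umat *v (\<chi> j. amp $ j * coord u j)"
    by (rule coord_inverse[symmetric])
  also have "\<dots> = v"
    unfolding assms by (rule coord_inverse)
  finally show ?thesis .
qed

lemma coord_scale [simp]: "coord (k *s v) j = k * coord v j"
  by (simp add: coord_def matrix_vector_mult_def sum_distrib_left algebra_simps)

lemma coord_orbit [simp]: "coord (orbit s) j = exp (- \<i> * freq $ j * s)"
  by (simp add: orbit_def)

lemma norm_coord_orbit: "norm (coord (orbit s) j) = 1"
proof -
  have "coord (orbit s) j = exp (\<i> * of_real (- freq $ j * s))"
    by (simp add: mult.assoc)
  then show ?thesis
    by (simp only: norm_exp_i_times)
qed

lemma coord_zero [simp]: "coord 0 j = 0"
  by (simp add: coord_def)

lemma hform_coord: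
  "hform u v = - (a^2 * (cnj (coord u 1) * coord v 1)) + b^2 * (cnj (coord u 2) * coord v 2)
     + c^2 * (cnj (coord u 3) * coord v 3)"
proof -
  have c: "\<i> * of_real c * x * (\<i> * of_real c * y) = - (of_real c * of_real c * (x * y))" for x y
  proof -
    have "\<i> * of_real c * x * (\<i> * of_real c * y) = (\<i> * \<i>) * (of_real c * of_real c * (x * y))"
      by (simp only: mult_ac)
    then show ?thesis by simp
  qed
  have "hform u v = hform (Umat *v (\<chi> j. amp $ j * coord u j)) (Umat *v (\<chi> j. amp $ j * coord v j))"
    by (simp only: coord_inverse)
  also have "\<dots> = - (a^2 * (cnj (coord u 1) * coord v 1)) + b^2 * (cnj (coord u 2) * coord v 2)
     + c^2 * (cnj (coord u 3) * coord v 3)"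
    unfolding hform_Umat by (simp add: power2_eq_square c)
  finally show ?thesis .
qed

text \<open>Since \<open>Umat\<close> has determinant one, the only factor left is the product of
  the entries of \<open>amp\<close>.\<close>

lemma det3_coord:
  "det3 u v w = - \<i> * a * b * c * det3 (\<chi> j. coord u j) (\<chi> j. coord v j) (\<chi> j. coord w j)"
proof -
  have "det3 u v w = det3 (Umat *v (\<chi> j. amp $ j * coord u j)) (Umat *v (\<chi> j. amp $ j * coord v j))
      (Umat *v (\<chi> j. amp $ j * coord w j))"
    by (simp only: coord_inverse)
  also have "\<dots> = amp $ 1 * amp $ 2 * amp $ 3 * det3 (\<chi> j. coord u j) (\<chi> j. coord v j) (\<chi> j. coord w j)"
    unfolding det3_mult det_Umat unfolding det3_expand vec_lambda_beta by algebra
  finally show ?thesis by simp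
qed

lemma bounded_linear_coord: "bounded_linear (\<lambda>v. coord v j)"
proof -
  have "bounded_linear (\<lambda>v. (matrix_inv Umat *v v) $ j)"
    by (intro bounded_linear_compose[OF bounded_linear_vec_nth] matrix_vector_mul_bounded_linear)
  then have "bounded_linear (\<lambda>v. (matrix_inv Umat *v v) $ j * inverse (amp $ j))"
    by (rule bounded_linear_compose[OF bounded_linear_mult_left])
  then show ?thesis
    by (simp add: coord_def divide_inverse)
qed

lemma coord_deriv:
  assumes "smooth \<Gamma>"
  shows "((\<lambda>s. coord (\<Gamma> s) j) has_vector_derivative coord (vderiv \<Gamma> s) j) (at s)"
    and "((\<lambda>s. coord (vderiv \<Gamma> s) j) has_vector_derivative coord (vderiv (vderiv \<Gamma>) s) j) (at s)"
  using smooth_has_vector_derivative[OF assms, THEN bounded_linear.has_vector_derivative[OF bounded_linear_coord]]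
  by auto

section \<open>Speed, Hermitian form and determinant of curves inside the orbit\<close>

definition logd :: "(real \<Rightarrow> complex^3) \<Rightarrow> real \<Rightarrow> 3 \<Rightarrow> complex" where
  "logd \<Gamma> s j = coord (vderiv \<Gamma> s) j / coord (\<Gamma> s) j"

text \<open>The scale and the phase are chosen point by point, with no continuity in
  \<open>s\<close>. Regularity is asked of the lift only, and the proofs work with identities
  between its coordinates.\<close>

definition orbit_curve :: "(real \<Rightarrow> complex^3) \<Rightarrow> bool" where
  "orbit_curve \<Gamma> \<longleftrightarrow> smooth \<Gamma> \<and> (\<forall>s. \<exists>k \<theta>. k \<noteq> 0 \<and> \<Gamma> s = k *s orbit \<theta>)"

lemma orbit_nonzero: "orbit s \<noteq> 0"
proof
  assume "orbit s = 0"
  then have "coord (orbit s) 1 = 0"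
    by (simp del: coord_orbit)
  then show False
    by simp
qed

lemma orbit_curve_coord_nonzero: "orbit_curve \<Gamma> \<Longrightarrow> coord (\<Gamma> s) j \<noteq> 0"
proof -
  assume "orbit_curve \<Gamma>"
  then obtain k \<theta> where "k \<noteq> 0" "\<Gamma> s = k *s orbit \<theta>"
    unfolding orbit_curve_def by blast
  then show ?thesis
    by simp
qed

lemma orbit_curve_logd:
  assumes "orbit_curve \<Gamma>"
  shows "((\<lambda>s. coord (\<Gamma> s) j) has_vector_derivative logd \<Gamma> s j * coord (\<Gamma> s) j) (at s)"
    and "coord (vderiv \<Gamma> s) j = logd \<Gamma> s j * coord (\<Gamma> s) j"
proof -
  show 1: "coord (vderiv \<Gamma> s) j = logd \<Gamma> s j * coord (\<Gamma> s) j"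
    using orbit_curve_coord_nonzero[OF assms, of s j] by (simp add: logd_def)
  have "smooth \<Gamma>"
    using assms by (simp add: orbit_curve_def)
  then show "((\<lambda>s. coord (\<Gamma> s) j) has_vector_derivative logd \<Gamma> s j * coord (\<Gamma> s) j) (at s)"
    unfolding 1[symmetric] by (rule coord_deriv)
qed

text \<open>Written with conjugates instead of norms, so that both sides are products that can be
  differentiated.\<close>

lemma orbit_curve_moduli:
  assumes "orbit_curve \<Gamma>"
  shows "coord (\<Gamma> s) j * cnj (coord (\<Gamma> s) j) = coord (\<Gamma> s) 1 * cnj (coord (\<Gamma> s) 1)"
proof -
  obtain k \<theta> where "k \<noteq> 0" "\<Gamma> s = k *s orbit \<theta>"
    using assms unfolding orbit_curve_def by blast
  then show ?thesis
    by (simp del: coord_orbit add: norm_coord_orbit norm_mult flip: complex_norm_square)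
qed

text \<open>Both sides have degree \<open>P + R\<close>, so the scale cancels. The phases agree
  because \<open>R\<close> times the gap \<open>\<kappa> * P\<close> equals \<open>P\<close> times
  the gap \<open>\<kappa> * R\<close>.\<close>

lemma orbit_curve_relation:
  assumes "orbit_curve \<Gamma>"
  shows "coord (\<Gamma> s) 2 ^ R * coord (\<Gamma> s) 1 ^ P = coord (\<Gamma> s) 3 ^ P * coord (\<Gamma> s) 1 ^ R"
proof -
  obtain k \<theta> where "k \<noteq> 0" "\<Gamma> s = k *s orbit \<theta>"
    using assms unfolding orbit_curve_def by blast
  then show ?thesis
    by (simp add: power_mult_distrib flip: exp_of_nat_mult exp_add)
      (simp add: freq_simps field_simps flip: exp_add power_add)
qed

text \<open>Equal moduli make the differences of the rates purely imaginary, and the torus relation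
  puts them in the ratio \<open>P : R\<close>; hence one real function describes both.\<close>

lemma orbit_curve_speed:
  assumes "orbit_curve \<Gamma>"
  obtains \<psi> :: "real \<Rightarrow> real"
  where "\<And>s. logd \<Gamma> s 2 - logd \<Gamma> s 1 = \<i> * (\<kappa> * P * \<psi> s)"
    and "\<And>s. logd \<Gamma> s 3 - logd \<Gamma> s 1 = \<i> * (\<kappa> * R * \<psi> s)"
proof
  note d = orbit_curve_logd(1)[OF assms] and nz = orbit_curve_coord_nonzero[OF assms]
  define \<psi> where "\<psi> s = Im (logd \<Gamma> s 2 - logd \<Gamma> s 1) / (\<kappa> * P)" for s
  fix s
  have dc: "((\<lambda>s. cnj (coord (\<Gamma> s) j)) has_vector_derivative cnj (logd \<Gamma> s j) * cnj (coord (\<Gamma> s) j)) (at s)" for j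
    using has_vector_derivative_cnj[OF d] by simp
  have re: "Re (logd \<Gamma> s j) = Re (logd \<Gamma> s 1)" for j
  proof -
    have "logd \<Gamma> s j + cnj (logd \<Gamma> s j) = logd \<Gamma> s 1 + cnj (logd \<Gamma> s 1)"
      by (rule logderiv_unique[OF logderiv_mult[OF d dc] logderiv_mult[OF d dc] orbit_curve_moduli[OF assms]])
        (use nz in simp)
    then show ?thesis
      by (simp add: complex_eq_iff)
  qed
  have rel: "R * logd \<Gamma> s 2 + P * logd \<Gamma> s 1 = P * logd \<Gamma> s 3 + R * logd \<Gamma> s 1"
    by (rule logderiv_unique[OF logderiv_mult[OF logderiv_power[OF d] logderiv_power[OF d]]
        logderiv_mult[OF logderiv_power[OF d] logderiv_power[OF d]] orbit_curve_relation[OF assms]])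
      (use nz in simp)
  show 2: "logd \<Gamma> s 2 - logd \<Gamma> s 1 = \<i> * (\<kappa> * P * \<psi> s)"
    using pos re[of 2] by (simp add: \<psi>_def complex_eq_iff)
  have "P * (logd \<Gamma> s 3 - logd \<Gamma> s 1) = R * (logd \<Gamma> s 2 - logd \<Gamma> s 1)"
    using rel by (simp add: algebra_simps)
  also have "\<dots> = P * (\<i> * (\<kappa> * R * \<psi> s))"
    unfolding 2 by simp
  finally show "logd \<Gamma> s 3 - logd \<Gamma> s 1 = \<i> * (\<kappa> * R * \<psi> s)"
    using pos by simp
qed

text \<open>The relation \<open>a^2 = b^2 + c^2\<close> removes the first rate, so that only
  differences of rates enter.\<close>

lemma orbit_curve_hform:
  assumes "orbit_curve \<Gamma>"
    and 2: "logd \<Gamma> s 2 - logd \<Gamma> s 1 = \<i> * (\<kappa> * P * w)"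
    and 3: "logd \<Gamma> s 3 - logd \<Gamma> s 1 = \<i> * (\<kappa> * R * w)"
  shows "hform (\<Gamma> s) (vderiv \<Gamma> s) = \<i> * of_real ((norm (coord (\<Gamma> s) 1))^2 * drift * w)"
proof -
  let ?m = "coord (\<Gamma> s) 1 * cnj (coord (\<Gamma> s) 1)"
  have "cnj (coord (\<Gamma> s) j) * coord (vderiv \<Gamma> s) j = logd \<Gamma> s j * ?m" for j
    unfolding orbit_curve_logd(2)[OF assms(1)] using orbit_curve_moduli[OF assms(1), of s j]
    by (simp add: algebra_simps)
  then have "hform (\<Gamma> s) (vderiv \<Gamma> s)
      = - (a^2 * (logd \<Gamma> s 1 * ?m)) + b^2 * (logd \<Gamma> s 2 * ?m) + c^2 * (logd \<Gamma> s 3 * ?m)"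
    unfolding hform_coord by simp
  also have "complex_of_real (a^2) = of_real (b^2) + of_real (c^2)"
    using null by (simp flip: of_real_power of_real_add)
  also have "- ((of_real (b^2) + of_real (c^2)) * (logd \<Gamma> s 1 * ?m)) + b^2 * (logd \<Gamma> s 2 * ?m) + c^2 * (logd \<Gamma> s 3 * ?m)
      = ?m * (b^2 * (logd \<Gamma> s 2 - logd \<Gamma> s 1) + c^2 * (logd \<Gamma> s 3 - logd \<Gamma> s 1))"
    by (simp add: algebra_simps)
  also have "\<dots> = \<i> * of_real ((norm (coord (\<Gamma> s) 1))^2 * drift * w)"
    unfolding 2 3 drift_def by (simp add: algebra_simps flip: complex_norm_square)
  finally show ?thesis .
qed

text \<open>With \<open>l\<close> for x'/x and \<open>m\<close> for its derivative, x'' = (m + l^2)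
  x, and the left side is det(x, x', x''). The right side splits into a Vandermonde product and a
  term that vanishes when the rate differences keep a constant ratio.\<close>

lemma wronskian_logderivs:
  fixes x1 x2 x3 :: complex
  shows "x1 * ((l2 * x2) * ((m3 + l3^2) * x3) - (l3 * x3) * ((m2 + l2^2) * x2))
     - x2 * ((l1 * x1) * ((m3 + l3^2) * x3) - (l3 * x3) * ((m1 + l1^2) * x1))
     + x3 * ((l1 * x1) * ((m2 + l2^2) * x2) - (l2 * x2) * ((m1 + l1^2) * x1))
   = (x1 * x2 * x3) * ((l2 - l1) * (l3 - l1) * ((l3 - l1) - (l2 - l1))
     + ((l2 - l1) * (m3 - m1) - (l3 - l1) * (m2 - m1)))"
  by algebra

lemma orbit_curve_det3:
  assumes "orbit_curve \<Gamma>"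
    and 2: "\<And>s. logd \<Gamma> s 2 - logd \<Gamma> s 1 = \<i> * (\<kappa> * P * \<psi> s)"
    and 3: "\<And>s. logd \<Gamma> s 3 - logd \<Gamma> s 1 = \<i> * (\<kappa> * R * \<psi> s)"
  shows "det3 (\<Gamma> s) (vderiv \<Gamma> s) (vderiv (vderiv \<Gamma>) s)
    = - of_real (rot * \<psi> s ^ 3) * (coord (\<Gamma> s) 1 * coord (\<Gamma> s) 2 * coord (\<Gamma> s) 3)"
proof -
  let ?X = "\<lambda>j. coord (\<Gamma> s) j" and ?L = "logd \<Gamma> s"
  note nz = orbit_curve_coord_nonzero[OF assms(1)]
  have sm: "smooth \<Gamma>"
    using assms(1) by (simp add: orbit_curve_def)
  define M where "M j = coord (vderiv (vderiv \<Gamma>) s) j / coord (\<Gamma> s) j - ?L j ^ 2" for j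
  have dL: "((\<lambda>s. logd \<Gamma> s j) has_vector_derivative M j) (at s)" for j
  proof -
    have "((\<lambda>s. coord (vderiv \<Gamma> s) j / coord (\<Gamma> s) j) has_derivative
        (\<lambda>h. ((h *\<^sub>R coord (vderiv (vderiv \<Gamma>) s) j) * coord (\<Gamma> s) j
             - coord (vderiv \<Gamma> s) j * (h *\<^sub>R coord (vderiv \<Gamma> s) j)) / (coord (\<Gamma> s) j * coord (\<Gamma> s) j))) (at s)"
      using coord_deriv[OF sm] nz unfolding has_vector_derivative_def by (intro has_derivative_divide') auto
    then show ?thesis
      unfolding has_vector_derivative_def logd_def
      by (rule has_derivative_eq_rhs)
        (use nz in \<open>auto simp: M_def logd_def field_simps power2_eq_square scaleR_conv_of_real\<close>)
  qed
  \<comment> \<open>The proportionality itself is differentiated, so \<open>\<psi>\<close> never has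
    to be differentiable.\<close>
  have "((\<lambda>s. R * (logd \<Gamma> s 2 - logd \<Gamma> s 1)) has_vector_derivative R * (M 2 - M 1)) (at s)"
    by (intro derivative_intros dL)
  moreover have "((\<lambda>s. P * (logd \<Gamma> s 3 - logd \<Gamma> s 1)) has_vector_derivative P * (M 3 - M 1)) (at s)"
    by (intro derivative_intros dL)
  moreover have "(\<lambda>s. R * (logd \<Gamma> s 2 - logd \<Gamma> s 1)) = (\<lambda>s. P * (logd \<Gamma> s 3 - logd \<Gamma> s 1))"
    unfolding 2 3 by (simp add: algebra_simps)
  ultimately have M: "R * (M 2 - M 1) = P * (M 3 - M 1)"
    using vector_derivative_unique_at by simp
  have "P * ((?L 2 - ?L 1) * (M 3 - M 1)) = (?L 2 - ?L 1) * (R * (M 2 - M 1))"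
    unfolding M by simp
  also have "\<dots> = P * ((?L 3 - ?L 1) * (M 2 - M 1))"
    unfolding 2 3 by simp
  finally have van: "(?L 2 - ?L 1) * (M 3 - M 1) = (?L 3 - ?L 1) * (M 2 - M 1)"
    using pos by simp
  have X2: "coord (vderiv (vderiv \<Gamma>) s) j = (M j + ?L j ^ 2) * ?X j" for j
    using nz[of s j] by (simp add: M_def)
  have "det3 (\<Gamma> s) (vderiv \<Gamma> s) (vderiv (vderiv \<Gamma>) s) = - \<i> * a * b * c * (?X 1 * ?X 2 * ?X 3) *
      ((?L 2 - ?L 1) * (?L 3 - ?L 1) * ((?L 3 - ?L 1) - (?L 2 - ?L 1))
        + ((?L 2 - ?L 1) * (M 3 - M 1) - (?L 3 - ?L 1) * (M 2 - M 1)))"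
    by (subst det3_coord, unfold det3_expand vec_lambda_beta X2 orbit_curve_logd(2)[OF assms(1)]
        wronskian_logderivs, simp only: mult.assoc)
  also have "\<dots> = - \<i> * a * b * c * (?X 1 * ?X 2 * ?X 3) *
      (\<i> * (\<kappa> * P * \<psi> s) * (\<i> * (\<kappa> * R * \<psi> s)) * (\<i> * (\<kappa> * R * \<psi> s) - \<i> * (\<kappa> * P * \<psi> s)))"
    by (simp only: van diff_self add_0_right) (simp only: 2 3)
  \<comment> \<open>Leaving \<open>\<i>^4\<close> unevaluated makes this a polynomial identity in
    which \<i> is a free symbol.\<close>
  also have "\<dots> = \<i>^4 * - of_real (rot * \<psi> s ^ 3) * (?X 1 * ?X 2 * ?X 3)"
    unfolding rot_def of_real_mult of_real_power of_real_diff by algebra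
  finally show ?thesis
    by simp
qed

section \<open>Rigidity of natural parametrizations\<close>

lemma norm_coord_orbit_curve:
  assumes "orbit_curve \<Gamma>"
  shows "norm (coord (\<Gamma> s) j) = norm (coord (\<Gamma> s) 1)"
proof -
  have "complex_of_real ((norm (coord (\<Gamma> s) j))^2) = of_real ((norm (coord (\<Gamma> s) 1))^2)"
    unfolding complex_norm_square using orbit_curve_moduli[OF assms] .
  then show ?thesis
    by (metis norm_ge_zero of_real_eq_iff power2_eq_imp_eq)
qed

text \<open>The form gives \<open>?n^2 * drift * ?w = 1\<close>, the modulus of the determinant
  gives \<open>\<bar>rot * ?w ^ 3\<bar> * ?n ^ 3 = 1\<close>. Comparing the cube of the first with
  the square of the second through \<open>rot_drift\<close> eliminates \<open>?n\<close> and leaves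
  \<open>?w ^ 3 = 1\<close>.\<close>

lemma natural_unit_speed:
  assumes "orbit_curve \<Gamma>"
    and det: "\<And>s. det3 (\<Gamma> s) (vderiv \<Gamma> s) (vderiv (vderiv \<Gamma>) s) = -1"
    and herm: "\<And>s. hform (\<Gamma> s) (vderiv \<Gamma> s) = \<i>"
  shows "logd \<Gamma> s 2 - logd \<Gamma> s 1 = \<i> * (\<kappa> * P)" "logd \<Gamma> s 3 - logd \<Gamma> s 1 = \<i> * (\<kappa> * R)"
proof -
  obtain \<psi> where 2: "\<And>s. logd \<Gamma> s 2 - logd \<Gamma> s 1 = \<i> * (\<kappa> * P * \<psi> s)"
    and 3: "\<And>s. logd \<Gamma> s 3 - logd \<Gamma> s 1 = \<i> * (\<kappa> * R * \<psi> s)"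
    using orbit_curve_speed[OF assms(1)] by metis
  let ?n = "norm (coord (\<Gamma> s) 1)" and ?w = "\<psi> s"
  have "\<i> * of_real (?n^2 * drift * ?w) = \<i> * of_real 1"
    using orbit_curve_hform[OF assms(1) 2 3] herm by simp
  then have h: "?n^2 * drift * ?w = 1"
    by (simp only: mult_cancel_left complex_i_not_zero of_real_eq_iff) simp
  have "of_real (rot * ?w ^ 3) * (coord (\<Gamma> s) 1 * coord (\<Gamma> s) 2 * coord (\<Gamma> s) 3) = 1"
    using orbit_curve_det3[OF assms(1) 2 3, of s] det[of s] by simp
  then have "norm (of_real (rot * ?w ^ 3) * (coord (\<Gamma> s) 1 * coord (\<Gamma> s) 2 * coord (\<Gamma> s) 3)) = 1"
    by (simp only: norm_one)
  then have "\<bar>rot * ?w ^ 3\<bar> * ?n ^ 3 = 1"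
    using norm_coord_orbit_curve[OF assms(1), of s 2] norm_coord_orbit_curve[OF assms(1), of s 3]
    by (simp only: norm_mult norm_of_real) (simp add: power3_eq_cube)
  then have d: "(\<bar>rot * ?w ^ 3\<bar> * ?n ^ 3)^2 = 1"
    by simp
  then have "(rot^2 * ?n ^ 6 * ?w ^ 3) * ?w ^ 3 = 1"
    unfolding power_mult_distrib power2_abs by algebra
  also have "rot^2 * ?n ^ 6 * ?w ^ 3 = (?n^2 * drift * ?w) ^ 3"
    unfolding rot_drift[symmetric] by algebra
  finally have "?w ^ 3 = 1"
    unfolding h by simp
  then have "(?w - 1) * (?w^2 + ?w + 1) = 0"
    by algebra
  moreover have "0 < ?n^2 * drift"
    using orbit_curve_coord_nonzero[OF assms(1)] drift_pos by simp
  then have "0 < ?w"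
    using h by (metis zero_less_mult_pos zero_less_one)
  then have "0 < ?w^2 + ?w + 1"
    by (simp add: add_pos_pos)
  ultimately have "?w = 1"
    by simp
  then show "logd \<Gamma> s 2 - logd \<Gamma> s 1 = \<i> * (\<kappa> * P)" "logd \<Gamma> s 3 - logd \<Gamma> s 1 = \<i> * (\<kappa> * R)"
    unfolding 2 3 by simp_all
qed

text \<open>At unit speed the determinant condition makes the product of the coordinates constant,
  so the rates sum to zero. Together with the two known differences this fixes all three
  rates.\<close>

lemma unit_speed_coord:
  assumes "orbit_curve \<Gamma>"
    and det: "\<And>s. det3 (\<Gamma> s) (vderiv \<Gamma> s) (vderiv (vderiv \<Gamma>) s) = -1"
    and 2: "\<And>s. logd \<Gamma> s 2 - logd \<Gamma> s 1 = \<i> * (\<kappa> * P)"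
    and 3: "\<And>s. logd \<Gamma> s 3 - logd \<Gamma> s 1 = \<i> * (\<kappa> * R)"
  shows "coord (\<Gamma> s) j = coord (\<Gamma> 0) j * exp (- \<i> * freq $ j * s)"
proof -
  note d = orbit_curve_logd(1)[OF assms(1)] and nz = orbit_curve_coord_nonzero[OF assms(1)]
  have "of_real rot * (coord (\<Gamma> s) 1 * coord (\<Gamma> s) 2 * coord (\<Gamma> s) 3) = 1" for s
    using orbit_curve_det3[OF assms(1), of "\<lambda>_. 1" s] 2 3 det[of s] by simp
  then have c: "coord (\<Gamma> s) 1 * coord (\<Gamma> s) 2 * coord (\<Gamma> s) 3 = inverse (of_real rot)" for s
    by (rule inverse_unique[symmetric])
  have sum: "logd \<Gamma> s 1 + logd \<Gamma> s 2 + logd \<Gamma> s 3 = 0" for s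
    by (rule logderiv_unique[OF logderiv_mult[OF logderiv_mult[OF d d] d], where g = "\<lambda>_. inverse (of_real rot)"])
      (use c nz rot_pos in auto)
  have l: "logd \<Gamma> s j = - \<i> * freq $ j" for s j
  proof -
    have "3 * logd \<Gamma> s 1 = - (logd \<Gamma> s 2 - logd \<Gamma> s 1) - (logd \<Gamma> s 3 - logd \<Gamma> s 1)"
      using sum[of s] by (simp add: algebra_simps add_eq_0_iff)
    also have "\<dots> = 3 * (- \<i> * freq $ 1)"
      unfolding 2 3 by (simp add: freq_simps algebra_simps)
    finally have 1: "logd \<Gamma> s 1 = - \<i> * freq $ 1"
      by simp
    have "logd \<Gamma> s 2 = - \<i> * freq $ 2" "logd \<Gamma> s 3 = - \<i> * freq $ 3"
      using 2[of s] 3[of s] unfolding 1 by (simp_all add: freq_simps field_simps)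
    with 1 show ?thesis
      using exhaust_3[of j] by auto
  qed
  show ?thesis
    using d unfolding l by (rule logderiv_const)
qed

lemma lift_orbit_curve:
  assumes "is_lift \<Gamma> \<gamma>" "range \<gamma> \<subseteq> range (\<lambda>s. pt (orbit s))"
  shows "orbit_curve \<Gamma>"
  unfolding orbit_curve_def
proof (intro conjI allI)
  show "smooth \<Gamma>"
    using assms(1) by (simp add: is_lift_def)
  fix s
  have "\<gamma> s \<in> range (\<lambda>s. pt (orbit s))"
    using assms(2) by blast
  then obtain \<theta> where "pt (\<Gamma> s) = pt (orbit \<theta>)"
    using assms(1) by (auto simp: is_lift_def)
  moreover have "\<Gamma> s \<noteq> 0"
    using assms(1) by (simp add: is_lift_def null_vectors_def)
  ultimately have "\<exists>k. k \<noteq> 0 \<and> \<Gamma> s = k *s orbit \<theta>"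
    using pt_eq_iff orbit_nonzero by blast
  then show "\<exists>k \<theta>. k \<noteq> 0 \<and> \<Gamma> s = k *s orbit \<theta>"
    by blast
qed

text \<open>Naturality provides some lift \<open>\<Delta>\<close> with both normalisations, and unit
  speed is proved for it. Differences of rates are the same for every lift, so unit speed passes to
  \<open>\<Gamma>\<close>.\<close>

lemma Wilczynski_lift_coord:
  assumes "natural_curve \<gamma>" "range \<gamma> \<subseteq> range (\<lambda>s. pt (orbit s))" "Wilczynski_lift \<Gamma> \<gamma>"
  shows "coord (\<Gamma> s) j = coord (\<Gamma> 0) j * exp (- \<i> * freq $ j * s)"
proof -
  obtain \<Delta> where \<Delta>: "Wilczynski_lift \<Delta> \<gamma>" and inv: "\<And>s. \<i> * inverse (hform (\<Delta> s) (vderiv \<Delta> s)) = 1"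
    using assms(1) unfolding natural_curve_def by blast
  have oc: "orbit_curve \<Gamma>" "orbit_curve \<Delta>"
    using assms \<Delta> lift_orbit_curve by (auto simp: Wilczynski_lift_def)
  have herm: "hform (\<Delta> s) (vderiv \<Delta> s) = \<i>" for s
    using inv[of s] by (cases "hform (\<Delta> s) (vderiv \<Delta> s) = 0") (auto simp: field_simps)
  have det: "det3 (\<Delta> s) (vderiv \<Delta> s) (vderiv (vderiv \<Delta>) s) = -1"
    "det3 (\<Gamma> s) (vderiv \<Gamma> s) (vderiv (vderiv \<Gamma>) s) = -1" for s
    using \<Delta> assms(3) by (auto simp: Wilczynski_lift_def)
  \<comment> \<open>Cross-multiplication eliminates the pointwise factor between the lifts, whose
    differentiability is not known at this stage.\<close>
  have proportional: "coord (\<Gamma> s) j * coord (\<Delta> s) 1 = coord (\<Delta> s) j * coord (\<Gamma> s) 1" for s j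
  proof -
    have "pt (\<Gamma> s) = pt (\<Delta> s)" "\<Gamma> s \<noteq> 0" "\<Delta> s \<noteq> 0"
      using assms(3) \<Delta> by (auto simp: Wilczynski_lift_def is_lift_def null_vectors_def)
    then obtain k where "\<Gamma> s = k *s \<Delta> s"
      using pt_eq_iff by blast
    then show ?thesis
      by simp
  qed
  have "logd \<Gamma> s j + logd \<Delta> s 1 = logd \<Delta> s j + logd \<Gamma> s 1" for s j
    by (rule logderiv_unique[OF logderiv_mult logderiv_mult proportional])
      (use oc orbit_curve_logd(1) orbit_curve_coord_nonzero in auto)
  then have "logd \<Gamma> s j - logd \<Gamma> s 1 = logd \<Delta> s j - logd \<Delta> s 1" for s j
    by (simp add: algebra_simps)
  then show ?thesis
    using natural_unit_speed[OF oc(2) det(1) herm] by (intro unit_speed_coord[OF oc(1) det(2)]) simp_all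
qed

subsection \<open>The orbit as a natural parametrization\<close>

text \<open>A family closed under \<open>vderiv\<close>, as only the coefficients \<open>A\<close>
  change; smoothness then follows by induction.\<close>

definition exp_curve :: "complex^3 \<Rightarrow> real \<Rightarrow> complex^3" where
  "exp_curve A s = Umat *v (\<chi> j. amp $ j * (A $ j * exp (- \<i> * freq $ j * s)))"

lemma coord_exp_curve [simp]: "coord (exp_curve A s) j = A $ j * exp (- \<i> * freq $ j * s)"
  by (simp add: exp_curve_def)

lemma exp_curve_deriv:
  "(exp_curve A has_vector_derivative exp_curve (\<chi> j. - \<i> * freq $ j * A $ j) s) (at s)"
proof -
  have "((\<lambda>s. \<chi> j. amp $ j * (A $ j * exp (- \<i> * freq $ j * of_real s))) has_vector_derivative
      (\<chi> j. amp $ j * ((- \<i> * freq $ j * A $ j) * exp (- \<i> * freq $ j * of_real s)))) (at s)"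
    unfolding has_vector_derivative_def
  proof (subst has_derivative_componentwise_within, intro ballI)
    fix e :: "complex^3"
    assume "e \<in> Basis"
    then obtain i u where e: "e = axis i u"
      by (auto simp: Basis_vec_def)
    have "((\<lambda>s. amp $ i * (A $ i * exp (- \<i> * freq $ i * of_real s))) has_vector_derivative
        amp $ i * ((- \<i> * freq $ i * A $ i) * exp (- \<i> * freq $ i * of_real s))) (at s)"
      using has_vector_derivative_mult_right[OF logderiv_exp[of "- \<i> * freq $ i" s], of "amp $ i * A $ i"]
      by (simp only: mult_ac)
    then show "((\<lambda>s. (\<chi> j. amp $ j * (A $ j * exp (- \<i> * freq $ j * of_real s))) \<bullet> e) has_derivative
        (\<lambda>h. (h *\<^sub>R (\<chi> j. amp $ j * ((- \<i> * freq $ j * A $ j) * exp (- \<i> * freq $ j * of_real s)))) \<bullet> e)) (at s)"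
      unfolding e inner_axis vec_lambda_beta vector_scaleR_component has_vector_derivative_def
      by (rule has_derivative_inner_left)
  qed
  then show ?thesis
    unfolding exp_curve_def
    by (auto intro: bounded_linear.has_vector_derivative[OF matrix_vector_mul_bounded_linear])
qed

lemma vderiv_exp_curve: "vderiv (exp_curve A) = exp_curve (\<chi> j. - \<i> * freq $ j * A $ j)"
  by (simp add: vderiv_def fun_eq_iff vector_derivative_at[OF exp_curve_deriv])

lemma smooth_exp_curve: "smooth (exp_curve A)"
proof -
  have "\<exists>B. (vderiv ^^ k) (exp_curve A) = exp_curve B" for k
  proof (induction k)
    case (Suc k)
    then obtain B where "(vderiv ^^ k) (exp_curve A) = exp_curve B"
      by blast
    then show ?case
      by (intro exI) (simp add: vderiv_exp_curve)
  qed auto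
  then have "(vderiv ^^ k) (exp_curve A) differentiable at t" for k t
    using differentiableI_vector[OF exp_curve_deriv[of _ t]] by metis
  then show ?thesis
    by (simp add: smooth_def)
qed

section \<open>Periods of the projective orbit\<close>

definition period :: real where
  "period = 2 * pi / \<kappa>"

lemma period_pos: "0 < period"
  using pos by (simp add: period_def)

lemma freq_diff: "freq $ 1 - freq $ 2 = \<kappa> * P" "freq $ 1 - freq $ 3 = \<kappa> * R"
  by (simp_all add: freq_simps field_simps)

text \<open>A common phase means that the shift by \<open>t\<close> acts as a scalar. This makes
  \<open>\<kappa> * P * t\<close> and \<open>\<kappa> * R * t\<close> multiples of
  \<open>2 * pi\<close>, and coprimality of \<open>P\<close> and \<open>R\<close> brings this down
  to \<open>\<kappa> * t\<close>.\<close>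

lemma same_phase_iff:
  fixes t :: real
  shows "(\<exists>k. \<forall>j. exp (- \<i> * freq $ j * t) = k) \<longleftrightarrow> (\<exists>i::int. t = i * period)"
proof
  assume "\<exists>k. \<forall>j. exp (- \<i> * freq $ j * t) = k"
  then obtain k where k: "\<And>j. exp (- \<i> * freq $ j * t) = k"
    by blast
  have "k \<noteq> 0"
    using k[of 1] by auto
  have "\<exists>n::int. (freq $ 1 - freq $ j) * t = 2 * pi * n" for j
  proof -
    have "exp (- \<i> * freq $ j * t - (- \<i> * freq $ 1 * t)) = 1"
      unfolding exp_diff k using \<open>k \<noteq> 0\<close> by simp
    then obtain n :: int where "Im (- \<i> * freq $ j * t - (- \<i> * freq $ 1 * t)) = of_int (2 * n) * pi"
      unfolding exp_eq_1 by blast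
    moreover have "Im (- \<i> * freq $ j * t - (- \<i> * freq $ 1 * t)) = (freq $ 1 - freq $ j) * t"
      by (simp add: left_diff_distrib)
    ultimately have "(freq $ 1 - freq $ j) * t = of_int (2 * n) * pi"
      by simp
    then show ?thesis
      by (intro exI[of _ n]) (simp add: mult_ac)
  qed
  from this[of 2] this[of 3] obtain u v :: int
    where u: "\<kappa> * P * t = 2 * pi * u" and v: "\<kappa> * R * t = 2 * pi * v"
    unfolding freq_diff by blast
  \<comment> \<open>Bezout coefficients express \<open>\<kappa> * t\<close> as an integer
    combination of the two known multiples of \<open>2 * pi\<close>.\<close>
  obtain x y :: int where xy: "x * int P + y * int R = 1"
  proof -
    have "gcd (int P) (int R) = 1"
      using coprime by (metis coprime_iff_gcd_eq_1 coprime_int_iff)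
    then show ?thesis
      using bezout_int[of "int P" "int R"] that by metis
  qed
  have "\<kappa> * t = (of_int (x * int P + y * int R)) * (\<kappa> * t)"
    unfolding xy by simp
  also have "\<dots> = x * (\<kappa> * P * t) + y * (\<kappa> * R * t)"
    by (simp add: algebra_simps)
  also have "\<dots> = 2 * pi * of_int (x * u + y * v)"
    unfolding u v by (simp add: algebra_simps)
  finally have "t = of_int (x * u + y * v) * period"
    using pos by (simp add: period_def field_simps)
  then show "\<exists>i::int. t = i * period"
    by blast
next
  assume "\<exists>i::int. t = i * period"
  then obtain i :: int where i: "\<kappa> * t = 2 * pi * i"
    using pos by (auto simp: period_def)
  have "exp (- \<i> * freq $ j * t) = exp (- \<i> * freq $ 1 * t)" for j
  proof -
    obtain n :: int where n: "freq $ j = freq $ 1 - \<kappa> * n"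
    proof (cases "j = 1"; cases "j = 2")
      assume "j \<noteq> 1" "j \<noteq> 2"
      then have "j = 3"
        using exhaust_3[of j] by simp
      then show ?thesis
        using freq_diff(2) by (intro that[of "int R"]) simp
    next
      assume "j \<noteq> 1" "j = 2"
      then show ?thesis
        using freq_diff(1) by (intro that[of "int P"]) simp
    qed (auto intro: that[of 0])
    have "- \<i> * freq $ j * t = - \<i> * freq $ 1 * t + \<i> * of_real (\<kappa> * t) * n"
      unfolding n by (simp add: algebra_simps)
    also have "\<dots> = - \<i> * freq $ 1 * t + of_int (2 * (i * n)) * pi * \<i>"
      unfolding i by (simp add: algebra_simps)
    finally show ?thesis
      unfolding exp_eq by blast
  qed
  then show "\<exists>k. \<forall>j. exp (- \<i> * freq $ j * t) = k"
    by blast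
qed

text \<open>The nonzero initial coordinates cancel, so proportional vectors are exactly those whose
  three phase changes agree.\<close>

lemma pt_eq_iff_period:
  fixes \<Gamma> :: "real \<Rightarrow> complex^3"
  assumes \<Gamma>: "\<And>s j. coord (\<Gamma> s) j = coord (\<Gamma> 0) j * exp (- \<i> * freq $ j * s)"
    and nz: "\<And>j. coord (\<Gamma> 0) j \<noteq> 0"
  shows "pt (\<Gamma> s) = pt (\<Gamma> s') \<longleftrightarrow> (\<exists>i::int. s - s' = i * period)"
proof -
  have "\<Gamma> s \<noteq> 0" for s
    using coord_zero[of 1] \<Gamma>[of s 1] nz[of 1] by (metis exp_not_eq_zero mult_eq_0_iff)
  then have "pt (\<Gamma> s) = pt (\<Gamma> s') \<longleftrightarrow> (\<exists>k. k \<noteq> 0 \<and> \<Gamma> s = k *s \<Gamma> s')"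
    using pt_eq_iff by blast
  also have "\<dots> \<longleftrightarrow> (\<exists>k. \<forall>j. exp (- \<i> * freq $ j * of_real (s - s')) = k)"
  proof -
    have "k \<noteq> 0 \<and> \<Gamma> s = k *s \<Gamma> s' \<longleftrightarrow> (\<forall>j. exp (- \<i> * freq $ j * of_real (s - s')) = k)" for k
    proof -
      have "\<Gamma> s = k *s \<Gamma> s' \<longleftrightarrow> (\<forall>j. coord (\<Gamma> s) j = k * coord (\<Gamma> s') j)"
      proof
        assume "\<forall>j. coord (\<Gamma> s) j = k * coord (\<Gamma> s') j"
        then show "\<Gamma> s = k *s \<Gamma> s'"
          by (intro coord_eqI) simp
      qed simp
      also have "\<dots> \<longleftrightarrow> (\<forall>j. exp (- \<i> * freq $ j * s) = k * exp (- \<i> * freq $ j * s'))"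
        using nz unfolding \<Gamma>[of s] \<Gamma>[of s'] by (simp add: mult.left_commute[of k])
      also have "\<dots> \<longleftrightarrow> (\<forall>j. exp (- \<i> * freq $ j * of_real (s - s')) = k)"
      proof -
        have "- \<i> * freq $ j * of_real (s - s') = - \<i> * freq $ j * s - - \<i> * freq $ j * s'" for j
          by (simp add: algebra_simps)
        then show ?thesis
          by (simp only: exp_diff) (simp add: divide_eq_eq)
      qed
      finally show ?thesis
        by (metis exp_not_eq_zero)
    qed
    then show ?thesis by blast
  qed
  finally show ?thesis
    unfolding same_phase_iff[of "s - s'"] by simp
qed

lemma minimal_period_iff:
  assumes "\<And>s s'. \<gamma> s = \<gamma> s' \<longleftrightarrow> (\<exists>i::int. s - s' = i * period)"
  shows "minimal_period \<gamma> \<omega> \<longleftrightarrow> \<omega> = period"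
proof
  have per: "(\<forall>s. \<gamma> (s + p) = \<gamma> s) \<longleftrightarrow> (\<exists>i::int. p = i * period)" for p
    unfolding assms by simp
  have le: "period \<le> p" if "p > 0" "p = of_int i * period" for p and i :: int
  proof -
    have "0 < i"
      using that period_pos by (simp add: zero_less_mult_iff)
    then show ?thesis
      using that(2) period_pos by simp
  qed
  have one: "\<exists>i::int. period = i * period"
    by (rule exI[of _ 1]) simp
  show "\<omega> = period" if "minimal_period \<gamma> \<omega>"
  proof -
    have "0 < \<omega>" "\<exists>i::int. \<omega> = i * period" "\<omega> \<le> period"
      using that one period_pos unfolding minimal_period_def per by auto
    with le show ?thesis
      by (metis antisym)
  qed
  show "minimal_period \<gamma> \<omega>" if "\<omega> = period"
    using le one period_pos unfolding minimal_period_def per that by blast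
qed

section \<open>A normalised lift of the orbit\<close>

definition natural_lift :: "real \<Rightarrow> complex^3" where
  "natural_lift = exp_curve (\<chi> j. of_real (root 3 (1 / rot)))"

lemma natural_lift_eq: "natural_lift s = of_real (root 3 (1 / rot)) *s orbit s"
  by (rule coord_eqI) (simp add: natural_lift_def)

lemma orbit_curve_natural_lift: "orbit_curve natural_lift"
  unfolding orbit_curve_def
proof (intro conjI allI)
  show "smooth natural_lift"
    by (simp add: natural_lift_def smooth_exp_curve)
  show "\<exists>k \<theta>. k \<noteq> 0 \<and> natural_lift s = k *s orbit \<theta>" for s
    using natural_lift_eq[of s] rot_pos by (intro exI[of _ "of_real (root 3 (1 / rot))"] exI[of _ s]) simp
qed

text \<open>The first equation is what the determinant requires of the scale, the second what the
  form requires. One scale serves both because \<open>drift ^ 3 = rot ^ 2\<close> and both numbers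
  are positive.\<close>

lemma natural_lift_scale: "root 3 (1 / rot) ^ 3 = 1 / rot" "root 3 (1 / rot) ^ 2 * drift = 1"
proof -
  define \<nu> where "\<nu> = root 3 (1 / rot)"
  show 3: "root 3 (1 / rot) ^ 3 = 1 / rot"
    using rot_pos by (intro real_root_pow_pos2) auto
  have "(\<nu> ^ 2 * drift) ^ 3 = (\<nu> ^ 3) ^ 2 * drift ^ 3"
    by (simp add: power_mult_distrib flip: power_mult)
  also have "\<dots> = 1"
    using rot_pos unfolding \<nu>_def 3 rot_drift by (simp add: power_divide)
  finally have "(\<nu> ^ 2 * drift) ^ 3 = 1 ^ 3"
    by simp
  then have "\<nu> ^ 2 * drift = 1"
    using drift_pos by (intro power_eq_imp_eq_base[of "\<nu> ^ 2 * drift" 3 1]) simp_all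
  then show "root 3 (1 / rot) ^ 2 * drift = 1"
    unfolding \<nu>_def .
qed

lemma logd_natural_lift: "logd natural_lift s j = - \<i> * freq $ j"
  using rot_pos by (simp add: logd_def natural_lift_def vderiv_exp_curve)

lemma natural_lift_speed:
  "logd natural_lift s 2 - logd natural_lift s 1 = \<i> * (\<kappa> * P * 1)"
  "logd natural_lift s 3 - logd natural_lift s 1 = \<i> * (\<kappa> * R * 1)"
proof -
  have "logd natural_lift s j - logd natural_lift s 1 = \<i> * of_real (freq $ 1 - freq $ j)" for j
    by (simp add: logd_natural_lift algebra_simps)
  then show "logd natural_lift s 2 - logd natural_lift s 1 = \<i> * (\<kappa> * P * 1)"
    "logd natural_lift s 3 - logd natural_lift s 1 = \<i> * (\<kappa> * R * 1)"
    by (simp_all only: freq_diff mult_1_right)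
qed

lemma natural_lift_hform: "hform (natural_lift s) (vderiv natural_lift s) = \<i>"
proof -
  have "norm (coord (natural_lift s) 1) = root 3 (1 / rot)"
    using rot_pos norm_coord_orbit[of s 1] by (simp add: natural_lift_eq norm_mult del: coord_orbit)
  then show ?thesis
    using orbit_curve_hform[OF orbit_curve_natural_lift natural_lift_speed[of s]]
    by (simp add: natural_lift_scale)
qed

lemma natural_lift_det3:
  "det3 (natural_lift s) (vderiv natural_lift s) (vderiv (vderiv natural_lift) s) = -1"
proof -
  let ?\<nu> = "complex_of_real (root 3 (1 / rot))"
  have "- \<i> * freq $ 1 * s + - \<i> * freq $ 2 * s + - \<i> * freq $ 3 * s
      = - \<i> * s * of_real (freq $ 1 + freq $ 2 + freq $ 3)"
    by (simp add: algebra_simps)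
  also have "freq $ 1 + freq $ 2 + freq $ 3 = 0"
    by (simp add: freq_simps field_simps)
  finally have e: "exp (- \<i> * freq $ 1 * s) * exp (- \<i> * freq $ 2 * s) * exp (- \<i> * freq $ 3 * s) = 1"
    unfolding exp_add[symmetric] by simp
  have "coord (natural_lift s) 1 * coord (natural_lift s) 2 * coord (natural_lift s) 3
      = ?\<nu> ^ 3 * (exp (- \<i> * freq $ 1 * s) * exp (- \<i> * freq $ 2 * s) * exp (- \<i> * freq $ 3 * s))"
    unfolding natural_lift_eq coord_scale coord_orbit by algebra
  also have "\<dots> = of_real (1 / rot)"
    unfolding e by (simp add: natural_lift_scale flip: of_real_power)
  finally show ?thesis
    using orbit_curve_det3[OF orbit_curve_natural_lift natural_lift_speed, of s] rot_pos by simp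
qed

lemma is_lift_natural_lift: "is_lift natural_lift (\<lambda>s. pt (orbit s))"
  unfolding is_lift_def
proof (intro conjI allI)
  show "smooth natural_lift"
    using orbit_curve_natural_lift by (simp add: orbit_curve_def)
  fix s
  have nz: "natural_lift s \<noteq> 0"
    using orbit_curve_coord_nonzero[OF orbit_curve_natural_lift, of s 1] by auto
  have m: "cnj (coord (natural_lift s) j) * coord (natural_lift s) j
      = cnj (coord (natural_lift s) 1) * coord (natural_lift s) 1" for j
    using orbit_curve_moduli[OF orbit_curve_natural_lift, of s j] by (simp only: mult.commute)
  have "hform (natural_lift s) (natural_lift s)
      = of_real (- (a^2) + b^2 + c^2) * (cnj (coord (natural_lift s) 1) * coord (natural_lift s) 1)"
    unfolding hform_coord m[of 2] m[of 3] by (simp add: algebra_simps)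
  also have "\<dots> = 0"
    using null by simp
  finally show "natural_lift s \<in> null_vectors"
    using nz by (simp add: null_vectors_def)
  show "pt (orbit s) = pt (natural_lift s)"
  proof (rule sym, rule pt_eq_iff[OF nz orbit_nonzero, THEN iffD2])
    show "\<exists>k. k \<noteq> 0 \<and> natural_lift s = k *s orbit s"
      using natural_lift_eq[of s] rot_pos by (intro exI[of _ "of_real (root 3 (1 / rot))"]) simp
  qed
qed

lemma Wilczynski_natural_lift: "Wilczynski_lift natural_lift (\<lambda>s. pt (orbit s))"
  by (simp add: Wilczynski_lift_def is_lift_natural_lift natural_lift_det3)

lemma natural_curve_orbit: "natural_curve (\<lambda>s. pt (orbit s))"
  unfolding natural_curve_def
  using Wilczynski_natural_lift by (intro exI[of _ natural_lift]) (simp add: natural_lift_hform)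

lemma natural_curve_eq_iff:
  assumes "natural_curve \<gamma>" "range \<gamma> \<subseteq> range (\<lambda>s. pt (orbit s))"
  shows "\<gamma> s = \<gamma> s' \<longleftrightarrow> (\<exists>i::int. s - s' = i * period)"
proof -
  obtain \<Gamma> where \<Gamma>: "Wilczynski_lift \<Gamma> \<gamma>"
    using assms(1) by (auto simp: natural_curve_def)
  then have lift: "is_lift \<Gamma> \<gamma>"
    by (simp add: Wilczynski_lift_def)
  then have "\<gamma> s = pt (\<Gamma> s)" for s
    by (simp add: is_lift_def)
  then show ?thesis
    using pt_eq_iff_period[OF Wilczynski_lift_coord[OF assms \<Gamma>]
        orbit_curve_coord_nonzero[OF lift_orbit_curve[OF lift assms(2)]], of s s'] by simp
qed

text \<open>Provides the existence half of the definite description in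
  \<open>monodromy\<close>.\<close>

lemma natural_parametrization_orbit:
  "natural_parametrization (\<lambda>s. pt (orbit s)) period (range (\<lambda>s. pt (orbit s)))"
proof -
  have eq: "pt (orbit s) = pt (orbit s') \<longleftrightarrow> (\<exists>i::int. s - s' = i * period)" for s s'
    by (rule natural_curve_eq_iff[OF natural_curve_orbit order.refl])
  have "transversal (\<lambda>s. pt (orbit s))"
    unfolding transversal_def
    using is_lift_natural_lift by (intro exI[of _ natural_lift]) (simp add: natural_lift_hform)
  moreover have "generic (\<lambda>s. pt (orbit s))"
    unfolding generic_def
    using is_lift_natural_lift by (intro exI[of _ natural_lift]) (simp add: natural_lift_det3)
  moreover have "minimal_period (\<lambda>s. pt (orbit s)) period"
    using minimal_period_iff[OF eq, of period] by simp
  moreover have "inj_on (\<lambda>s. pt (orbit s)) {0..<period}"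
  proof (rule inj_onI)
    fix s s'
    assume s: "s \<in> {0..<period}" "s' \<in> {0..<period}" and "pt (orbit s) = pt (orbit s')"
    then obtain i :: int where i: "s - s' = i * period"
      using eq by blast
    \<comment> \<open>Two parameters in the half-open interval differ by less than one
      period.\<close>
    have "\<bar>real_of_int i * period\<bar> < period"
      unfolding i[symmetric] using s by auto
    then have "\<bar>real_of_int i\<bar> * period < 1 * period"
      using period_pos by (simp only: abs_mult abs_of_pos mult_1)
    then have "\<bar>real_of_int i\<bar> < 1"
      using period_pos mult_less_cancel_right_pos by blast
    then have "i = 0"
      by linarith
    with i show "s = s'"
      by simp
  qed
  ultimately show ?thesis
    using natural_curve_orbit by (simp add: natural_parametrization_def knot_parametrization_def)
qed

text \<open>Over one period all coordinates acquire the same phase; the first frequency gives its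
  value, as \<open>freq $ 1 * period\<close> is \<open>2 * pi * (P + R) / 3\<close>.\<close>

lemma Wilczynski_monodromy:
  assumes "natural_curve \<gamma>" "range \<gamma> \<subseteq> range (\<lambda>s. pt (orbit s))" "Wilczynski_lift \<Gamma> \<gamma>"
  shows "\<Gamma> period = \<epsilon> *s \<Gamma> 0 \<longleftrightarrow> \<epsilon> = cis (- (2 * pi * real (P + R) / 3))"
proof -
  have nz: "coord (\<Gamma> 0) j \<noteq> 0" for j
    using assms lift_orbit_curve orbit_curve_coord_nonzero by (auto simp: Wilczynski_lift_def)
  obtain k where k: "\<And>j. exp (- \<i> * freq $ j * period) = k"
    using same_phase_iff[of period] by (metis mult_1 of_int_1)
  have "- \<i> * freq $ 1 * period = \<i> * of_real (- (2 * pi * real (P + R) / 3))"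
    using pos by (simp add: freq_simps period_def field_simps)
  then have k': "k = cis (- (2 * pi * real (P + R) / 3))"
    unfolding k[of 1, symmetric] cis_conv_exp by (simp only:)
  have "coord (\<Gamma> period) j = k * coord (\<Gamma> 0) j" for j
    using Wilczynski_lift_coord[OF assms, of period j] unfolding k by simp
  then have "\<Gamma> period = k *s \<Gamma> 0"
    by (intro coord_eqI) simp
  then have "\<Gamma> period = \<epsilon> *s \<Gamma> 0 \<longleftrightarrow> k *s \<Gamma> 0 = \<epsilon> *s \<Gamma> 0"
    by simp
  also have "\<dots> \<longleftrightarrow> \<epsilon> = k"
  proof
    assume "k *s \<Gamma> 0 = \<epsilon> *s \<Gamma> 0"
    then have "k * coord (\<Gamma> 0) 1 = \<epsilon> * coord (\<Gamma> 0) 1"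
      by (metis coord_scale)
    then show "\<epsilon> = k"
      using nz by simp
  qed simp
  finally show ?thesis
    unfolding k' .
qed

lemma monodromy_orbit:
  "monodromy (range (\<lambda>s. pt (orbit s))) = cis (- (2 * pi * real (P + R) / 3))"
  unfolding monodromy_def
proof (rule the_equality)
  show "\<exists>\<gamma> \<omega> \<Gamma>. natural_parametrization \<gamma> \<omega> (range (\<lambda>s. pt (orbit s))) \<and> Wilczynski_lift \<Gamma> \<gamma>
      \<and> \<Gamma> \<omega> = cis (- (2 * pi * real (P + R) / 3)) *s \<Gamma> 0"
    using natural_parametrization_orbit Wilczynski_natural_lift
      Wilczynski_monodromy[OF natural_curve_orbit order.refl Wilczynski_natural_lift] by blast
next
  fix \<epsilon>
  assume "\<exists>\<gamma> \<omega> \<Gamma>. natural_parametrization \<gamma> \<omega> (range (\<lambda>s. pt (orbit s))) \<and> Wilczynski_lift \<Gamma> \<gamma>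
      \<and> \<Gamma> \<omega> = \<epsilon> *s \<Gamma> 0"
  then obtain \<gamma> \<omega> \<Gamma> where n: "natural_parametrization \<gamma> \<omega> (range (\<lambda>s. pt (orbit s)))"
    and w: "Wilczynski_lift \<Gamma> \<gamma>" and \<epsilon>: "\<Gamma> \<omega> = \<epsilon> *s \<Gamma> 0"
    by blast
  have nc: "natural_curve \<gamma>" and rg: "range \<gamma> \<subseteq> range (\<lambda>s. pt (orbit s))"
    and "minimal_period \<gamma> \<omega>"
    using n by (simp_all add: natural_parametrization_def knot_parametrization_def)
  then have "\<omega> = period"
    using minimal_period_iff[OF natural_curve_eq_iff[OF nc rg]] by simp
  then show "\<epsilon> = cis (- (2 * pi * real (P + R) / 3))"
    using Wilczynski_monodromy[OF nc rg w] \<epsilon> by simp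
qed

end

section \<open>Configurations of the second kind\<close>

lemma proj_map_pt: "proj_map A (pt v) = pt (A *v v)"
proof -
  have "A *v (k *s v) = k *s (A *v v)" for k
    by (simp add: vec_eq_iff matrix_vector_mult_def sum_distrib_left algebra_simps)
  then show ?thesis
    unfolding proj_map_def pt_def by (force simp: image_iff)
qed

text \<open>The entries on the right are the coordinates of the base point in the eigenbasis, and
  they become the amplitudes \<open>amp\<close> of the orbit.\<close>

lemma Spt_eq:
  "Spt \<rho> = pt (Umat *v vector [of_real ((1 + \<rho>^2/2) / sqrt 2), of_real \<rho>, - \<i> * of_real ((1 - \<rho>^2/2) / sqrt 2)])"
proof -
  have s: "complex_of_real (sqrt 2) * of_real (sqrt 2) = 2"
    by (simp flip: of_real_mult)
  have "Umat *v vector [of_real ((1 + \<rho>^2/2) / sqrt 2), of_real \<rho>, - \<i> * of_real ((1 - \<rho>^2/2) / sqrt 2)]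
      = vector [1, of_real \<rho>, \<i> * of_real (\<rho>^2) / 2]"
    by (simp add: vec_eq_iff forall_3 matrix_vector_mult_def sum_3 Umat_def s field_simps)
  then show ?thesis
    by (simp add: Spt_def)
qed

lemma config2_eq:
  "config2 r \<rho> s = pt (Umat *v vector
     [of_real ((1 + \<rho>^2/2) / sqrt 2) * exp (- \<i> * e23 r \<rho> * s),
      of_real \<rho> * exp (- \<i> * e22 r \<rho> * s),
      - \<i> * of_real ((1 - \<rho>^2/2) / sqrt 2) * exp (- \<i> * e21 r \<rho> * s)])"
proof -
  let ?d = "vector [- \<i> * e23 r \<rho> * s, - \<i> * e22 r \<rho> * s, - \<i> * e21 r \<rho> * s] :: complex^3"
  have "s *\<^sub>R D2 r \<rho> = (\<chi> i j. if i = j then ?d $ i else 0)"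
    by (simp add: vec_eq_iff forall_3 D2_def) (simp add: scaleR_conv_of_real)
  then have e: "mat_exp (s *\<^sub>R D2 r \<rho>) = (\<chi> i j. if i = j then exp (?d $ i) else 0)"
    by (simp only: mat_exp_diag)
  have "mat_exp (s *\<^sub>R D2 r \<rho>) *v vector [x, y, z] = vector
      [x * exp (- \<i> * e23 r \<rho> * s), y * exp (- \<i> * e22 r \<rho> * s), z * exp (- \<i> * e21 r \<rho> * s)]" for x y z
    unfolding e by (simp add: vec_eq_iff forall_3 matrix_vector_mult_def sum_3 mult.commute)
  then show ?thesis
    unfolding config2_def Spt_eq proj_map_pt by (simp only: matrix_vector_mul_assoc[symmetric] inv_Umat)
qed

text \<open>With \<open>t = e23 r \<rho>\<close> the orbit has \<open>drift = t * N\<close> and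
  \<open>rot = t^3 * V\<close>, so the equation is \<open>drift ^ 3 = rot ^ 2\<close> divided by
  \<open>t^3\<close>. The \<open>2/3\<close> power in \<open>mu2\<close> has base
  \<open>8 * V\<close>, which is where \<open>V ^ 2\<close> comes from.\<close>

lemma e23_cube:
  fixes r \<rho> :: real
  assumes "-2 < r" "r < -1/2" "0 < \<rho>" "\<rho> < sqrt 2"
  defines "N \<equiv> (2 + r) * \<rho>^2 + (1 - r) * ((1 - \<rho>^2/2) / sqrt 2)^2"
    and "V \<equiv> ((1 + \<rho>^2/2) / sqrt 2) * \<rho> * ((1 - \<rho>^2/2) / sqrt 2) * ((2 + r) * (1 - r) * (- 1 - 2 * r))"
  shows "0 < e23 r \<rho>" "N ^ 3 = e23 r \<rho> ^ 3 * V ^ 2"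
proof -
  define X where "X = ((2 + 3*r - 3*r^2 - 2*r^3) * (-4*\<rho> + \<rho>^5)) powr (2/3)"
  have \<rho>2: "\<rho>^2 < 2"
    using assms(3,4) by (metis abs_of_pos real_sqrt_abs real_sqrt_less_iff)
  have "V = ((1 + \<rho>^2/2) * (1 - \<rho>^2/2) * \<rho> / 2) * ((2 + r) * (1 - r) * (- 1 - 2 * r))"
    by (simp add: V_def)
  also have "8 * \<dots> = (2 + 3*r - 3*r^2 - 2*r^3) * (-4*\<rho> + \<rho>^5)"
    by (simp add: field_simps power_numeral_reduce)
  finally have V: "(2 + 3*r - 3*r^2 - 2*r^3) * (-4*\<rho> + \<rho>^5) = 8 * V" ..
  have f: "0 < 2 + r" "0 < 1 - r" "0 < - 1 - 2 * r" "0 < 1 + \<rho>^2/2" "0 < 1 - \<rho>^2/2"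
    using assms(1,2) \<rho>2 by (simp_all add: add_pos_nonneg)
  have Vpos: "0 < V"
    unfolding V_def using f assms(3) by (intro mult_pos_pos divide_pos_pos) simp_all
  have "0 < (2 + r) * \<rho>^2" "0 < (1 - r) * ((1 - \<rho>^2/2) / sqrt 2)^2"
    using f assms(3) by (intro mult_pos_pos zero_less_power divide_pos_pos; simp)+
  then have Npos: "0 < N"
    by (simp add: N_def)
  have "X ^ 3 = (8 * V) powr (2/3 * real 3)"
    unfolding X_def V using Vpos by (simp add: powr_power)
  also have "\<dots> = (8 * V) ^ 2"
    using Vpos by (simp add: powr_numeral)
  finally have X3: "X ^ 3 = 64 * V ^ 2"
    by (simp add: power_mult_distrib)
  have Xpos: "0 < X"
    using Vpos unfolding X_def V by simp
  \<comment> \<open>The numerator of \<open>mu2\<close> is thus a multiple of \<open>N\<close>, and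
    \<open>mu2 / (1 - mu2)\<close> collapses to \<open>4 * N / X\<close>.\<close>
  have "-4 + 4*r - 12*\<rho>^2*(1 + r) + (r - 1)*\<rho>^4 = - (8 * N)"
    unfolding N_def by (simp add: field_simps power_numeral_reduce)
  then have "mu2 r \<rho> = - (8 * N) / - (8 * N + 2 * X)"
    by (simp add: mu2_def X_def)
  then have mu: "mu2 r \<rho> = 8 * N / (8 * N + 2 * X)"
    by (simp only: minus_divide_divide)
  have mu': "1 - mu2 r \<rho> = 2 * X / (8 * N + 2 * X)"
    unfolding mu using add_pos_pos[OF Npos Xpos] Npos Xpos by (simp add: field_simps)
  have e: "e23 r \<rho> = 4 * N / X"
    unfolding e23_def mu' unfolding mu using Npos Xpos by simp
  show "0 < e23 r \<rho>"
    unfolding e using Npos Xpos by simp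
  show "N ^ 3 = e23 r \<rho> ^ 3 * V ^ 2"
    unfolding e power_divide X3 using Vpos by (simp add: power_mult_distrib)
qed

section \<open>Cube roots of unity and residues modulo three\<close>

lemma Arg2pi_cis:
  assumes "0 \<le> x" "x < 2 * pi"
  shows "Arg2pi (cis x) = x"
  by (rule Arg2pi_unique[of 1]) (use assms in \<open>auto simp: cis_conv_exp\<close>)

lemma cis_third:
  fixes i j :: int
  assumes "i = j + 3 * l"
  shows "cis (2 * pi * i / 3) = cis (2 * pi * j / 3)"
proof -
  have "cis (2 * pi * i / 3) = cis (2 * pi * j / 3) * cis (2 * pi * l)"
    unfolding cis_mult assms by (simp add: field_simps)
  then show ?thesis
    by (simp add: cis_multiple_2pi)
qed

text \<open>\<open>d = gcd (2 n + m) (n - m)\<close> divides \<open>3\<close>, and \<open>P + R = 3 n / d\<close>.\<close>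

lemma monodromy_trajectory2:
  fixes m n :: int and r \<rho> :: real
  assumes r: "r = of_int m / of_int n" "-2 < r" "r < -1/2"
    and mn: "coprime m n" "m < 0" and \<rho>: "0 < \<rho>" "\<rho> < sqrt 2"
  shows "monodromy (trajectory2 r \<rho>) = (if 3 dvd n - m then cis (2 * pi * of_int (- n) / 3) else 1)"
proof -
  have "real_of_int m / of_int n < 0"
    using r by simp
  then have n: "0 < n"
    using mn(2) by (simp add: divide_less_0_iff)
  define d where "d = gcd (2 * n + m) (n - m)"
  have pos: "0 < 2 * n + m" "0 < n - m" "n + 2 * m < 0"
  proof -
    have "r * of_int n = of_int m"
      using n r(1) by simp
    then have "- 2 * of_int n < real_of_int m" "real_of_int m < (- 1 / 2) * of_int n"
      using n r(2,3) mult_strict_right_mono[of _ _ "real_of_int n"] by (metis of_int_0_less_iff)+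
    then show "0 < 2 * n + m" "0 < n - m" "n + 2 * m < 0"
      using n mn(2) by linarith+
  qed
  have d0: "0 < d"
    using pos by (simp add: d_def gcd_pos_int)
  have dd: "d dvd 2 * n + m" "d dvd n - m"
    by (simp_all add: d_def)
  \<comment> \<open>These combinations are \<open>3 * n\<close> and \<open>3 * m\<close>, whose
    greatest common divisor is \<open>3\<close>.\<close>
  have "d dvd (2 * n + m) + (n - m)" "d dvd (2 * n + m) - 2 * (n - m)"
    using dd by (simp_all only: dvd_add dvd_diff dvd_mult)
  then have "d dvd 3 * n" "d dvd 3 * m"
    by (simp_all add: algebra_simps)
  then have "d dvd gcd (3 * m) (3 * n)"
    by simp
  also have "gcd (3 * m) (3 * n) = 3"
    using mn(1) by (simp add: gcd_mult_left)
  finally have d3: "d dvd 3" .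
  then have "d \<le> 3"
    by (rule zdvd_imp_le) simp
  then have "d = 1 \<or> d = 2 \<or> d = 3"
    using d0 by linarith
  then have d13: "d = 1 \<or> d = 3"
    using d3 by auto
  have d3_iff: "d = 3 \<longleftrightarrow> 3 dvd n - m"
  proof
    assume "3 dvd n - m"
    then have "3 dvd 3 * n - (n - m)"
      by (rule dvd_diff[OF dvd_triv_left])
    then have "3 dvd 2 * n + m"
      by (simp add: algebra_simps)
    with \<open>3 dvd n - m\<close> have "3 dvd d"
      by (simp add: d_def)
    with d13 show "d = 3"
      by auto
  qed (use dd in auto)
  define P R where "P = nat ((2 * n + m) div d)" and "R = nat ((n - m) div d)"
  have P: "int P * d = 2 * n + m" and R: "int R * d = n - m"
    using dd pos d0 by (simp_all add: P_def R_def pos_imp_zdiv_nonneg_iff)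
  define t where "t = e23 r \<rho>"
  \<comment> \<open>The frequency gaps are \<open>t * (2 + r)\<close> and
    \<open>t * (1 - r)\<close>, in the ratio of \<open>2 * n + m\<close> to \<open>n - m\<close>;
    \<open>d / n\<close> compensates for the division of these integers by \<open>d\<close>.\<close>
  define \<kappa> where "\<kappa> = t * d / n"
  define a b c where "a = (1 + \<rho>^2/2) / sqrt 2" and "b = \<rho>" and "c = (1 - \<rho>^2/2) / sqrt 2"
  note cube = e23_cube[OF r(2,3) \<rho>, folded t_def a_def b_def c_def]
  have PR: "real P * d = 2 * n + m" "real R * d = n - m"
    using P R by (metis of_int_mult of_int_of_nat_eq)+
  have "\<kappa> * P = t * ((real P * d) / n)" "\<kappa> * R = t * ((real R * d) / n)"
    by (simp_all add: \<kappa>_def)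
  then have \<kappa>P: "\<kappa> * P = t * (2 + r)" and \<kappa>R: "\<kappa> * R = t * (1 - r)"
    using n unfolding PR by (simp_all add: r(1) add_divide_distrib diff_divide_distrib)
  have \<rho>2: "\<rho>^2 < 2"
    using \<rho> by (metis abs_of_pos real_sqrt_abs real_sqrt_less_iff)
  interpret clifford_orbit a b c \<kappa> P R
  proof
    show "0 < a" "0 < b" "0 < c"
      using \<rho> \<rho>2 by (simp_all add: a_def b_def c_def add_pos_pos)
    show "0 < \<kappa>"
      using cube(1) n d0 by (simp add: \<kappa>_def)
    \<comment> \<open>Positivity of \<open>P\<close> comes from \<open>r > -2\<close>, and
      \<open>P < R\<close> from \<open>r < -1/2\<close>.\<close>
    have "0 < int P * d" "int P * d < int R * d"
      unfolding P R using pos by simp_all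
    then show "0 < P" "P < R"
      using d0 by (simp_all add: zero_less_mult_iff)
    show "a^2 = b^2 + c^2"
      by (simp add: a_def b_def c_def power_divide) (simp add: power2_eq_square field_simps)
    show "coprime P R"
    proof -
      have "gcd (int P * d) (int R * d) = d"
        unfolding P R by (simp add: d_def)
      then have "gcd (int P) (int R) * d = d"
        using d0 gcd_mult_distrib_int[of d "int P" "int R"] by (simp add: mult.commute)
      then have "gcd (int P) (int R) = 1"
        using d0 by simp
      then show ?thesis
        by (metis coprime_iff_gcd_eq_1 coprime_int_iff)
    qed
    have "\<kappa> * (b^2 * P + c^2 * R) = t * ((2 + r) * b^2 + (1 - r) * c^2)"
      using \<kappa>P \<kappa>R by algebra
    moreover have "a * b * c * \<kappa>^3 * P * R * (real R - real P)
        = t^3 * (a * b * c * ((2 + r) * (1 - r) * (- 1 - 2 * r)))"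
      using \<kappa>P \<kappa>R by algebra
    ultimately show "(\<kappa> * (b^2 * P + c^2 * R)) ^ 3 = (a * b * c * \<kappa>^3 * P * R * (real R - real P))^2"
      using cube(2) by (simp only: power_mult_distrib) (simp add: power2_eq_square)
  qed
  have f: "freq $ 1 = e23 r \<rho>" "freq $ 2 = e22 r \<rho>" "freq $ 3 = e21 r \<rho>"
  proof -
    have t': "t = mu2 r \<rho> / (1 - mu2 r \<rho>)"
      by (simp add: t_def e23_def)
    have "e22 r \<rho> = - (1 + r) * t" "e21 r \<rho> = r * t"
      by (simp_all add: e21_def e22_def t')
    moreover have "freq $ 1 = (\<kappa> * P + \<kappa> * R) / 3" "freq $ 2 = (\<kappa> * R - 2 * (\<kappa> * P)) / 3"
      "freq $ 3 = (\<kappa> * P - 2 * (\<kappa> * R)) / 3"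
      by (simp_all add: freq_simps algebra_simps)
    ultimately show "freq $ 1 = e23 r \<rho>" "freq $ 2 = e22 r \<rho>" "freq $ 3 = e21 r \<rho>"
      unfolding \<kappa>P \<kappa>R by (simp_all add: algebra_simps flip: t_def)
  qed
  have "config2 r \<rho> s = pt (orbit s)" for s
  proof -
    have v: "(\<chi> j. amp $ j * exp (- \<i> * freq $ j * s)) = vector
      [of_real a * exp (- \<i> * e23 r \<rho> * s), of_real b * exp (- \<i> * e22 r \<rho> * s),
       - \<i> * of_real c * exp (- \<i> * e21 r \<rho> * s)]"
      by (simp add: vec_eq_iff forall_3 f)
    show ?thesis
      unfolding orbit_def v unfolding config2_eq a_def b_def c_def ..
  qed
  then have "trajectory2 r \<rho> = range (\<lambda>s. pt (orbit s))"
    by (simp add: trajectory2_def)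
  then have mon: "monodromy (trajectory2 r \<rho>) = cis (- (2 * pi * real (P + R) / 3))"
    by (simp add: monodromy_orbit)
  \<comment> \<open>For \<open>d = 3\<close> the sum is \<open>n\<close>, and a cube root of unity
    remains; for \<open>d = 1\<close> it is \<open>3 * n\<close>, and the phase is a full multiple
    of \<open>2 * pi\<close>.\<close>
  have "int (P + R) * d = 3 * n"
    using P R by (simp add: algebra_simps)
  show ?thesis
  proof (cases "d = 3")
    case True
    with \<open>int (P + R) * d = 3 * n\<close> have "int (P + R) = n"
      by simp
    then have "real (P + R) = of_int n"
      by (metis of_int_of_nat_eq)
    then show ?thesis
      unfolding mon using True d3_iff by simp
  next
    case False
    with d13 \<open>int (P + R) * d = 3 * n\<close> have "int (P + R) = 3 * n"
      by simp
    then have "real (P + R) = 3 * of_int n"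
      by (metis of_int_of_nat_eq of_int_mult of_int_numeral)
    then have "- (2 * pi * real (P + R) / 3) = 2 * pi * of_int (- n)"
      by simp
    then show ?thesis
      unfolding mon using False d3_iff cis_multiple_2pi[of "of_int (- n)"] by (simp only: Ints_of_int if_False)
  qed
qed

theorem proposition4p14:
  fixes m n :: int and r \<rho> :: real
  assumes "r = of_int m / of_int n" and "-2 < r" and "r < -1/2"
    and "coprime m n" and "m < 0"
    and "0 < \<rho>" and "\<rho> < sqrt 2"
  shows "(CR_spin (trajectory2 r \<rho>) = 1/3 \<and> phase_anomaly (trajectory2 r \<rho>) = 4 * pi / 3 \<longleftrightarrow>
            (\<exists>h k::int. h < 0 \<and> k > 0 \<and> m = 1 + 3 * h \<and> n = 1 + 3 * k))
       \<and> (CR_spin (trajectory2 r \<rho>) = 1/3 \<and> phase_anomaly (trajectory2 r \<rho>) = 2 * pi / 3 \<longleftrightarrow>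
            (\<exists>h k::int. h < 0 \<and> k > 0 \<and> m = 2 + 3 * h \<and> n = 2 + 3 * k))"
proof -
  let ?K = "trajectory2 r \<rho>"
  have mon: "monodromy ?K = (if 3 dvd n - m then cis (2 * pi * of_int (- n) / 3) else 1)"
    using assms by (rule monodromy_trajectory2)
  have "real_of_int m / of_int n < 0"
    using assms(1,3) by simp
  then have n: "0 < n"
    using assms(5) by (simp add: divide_less_0_iff)
  have "r * of_int n = of_int m"
    using n assms(1) by simp
  then have "- 2 * of_int n < real_of_int m" "real_of_int m < (- 1 / 2) * of_int n"
    using n assms(2,3) mult_strict_right_mono[of _ _ "real_of_int n"] by (metis of_int_0_less_iff)+
  then have bounds: "- 2 * n < m" "2 * m < - n"
    by linarith+
  have A: "(\<exists>h k::int. h < 0 \<and> k > 0 \<and> m = 1 + 3 * h \<and> n = 1 + 3 * k) \<longleftrightarrow> m mod 3 = 1 \<and> n mod 3 = 1"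
    (is "?L \<longleftrightarrow> ?R")
  proof
    assume ?R
    then have e: "m = 1 + 3 * (m div 3)" "n = 1 + 3 * (n div 3)"
      by (metis add.commute mult.commute div_mult_mod_eq)+
    \<comment> \<open>The bounds on \<open>r\<close> leave only \<open>m = -1\<close> for this
      denominator, which has residue 2. Hence the quotient of \<open>n\<close> by three is strictly
      positive.\<close>
    have "n \<noteq> 1"
    proof
      assume "n = 1"
      with bounds have "m = -1"
        by linarith
      with \<open>?R\<close> show False
        by simp
    qed
    then have "n div 3 \<noteq> 0"
      using e(2) by auto
    moreover have "0 \<le> n div 3"
      using n by simp
    ultimately have "m div 3 < 0" "n div 3 > 0"
      using e(1) assms(5) by linarith+
    with e show ?L
      by blast
  qed auto
  have B: "(\<exists>h k::int. h < 0 \<and> k > 0 \<and> m = 2 + 3 * h \<and> n = 2 + 3 * k) \<longleftrightarrow> m mod 3 = 2 \<and> n mod 3 = 2"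
    (is "?L \<longleftrightarrow> ?R")
  proof
    assume ?R
    then have e: "m = 2 + 3 * (m div 3)" "n = 2 + 3 * (n div 3)"
      by (metis add.commute mult.commute div_mult_mod_eq)+
    \<comment> \<open>Here the bounds on \<open>r\<close> leave numerators of residue 0 or 1
      only.\<close>
    have "n \<noteq> 2"
    proof
      assume "n = 2"
      with bounds have "m = -3 \<or> m = -2"
        by linarith
      with \<open>?R\<close> show False
        by auto
    qed
    then have "n div 3 \<noteq> 0"
      using e(2) by auto
    moreover have "0 \<le> n div 3"
      using n by simp
    ultimately have "m div 3 < 0" "n div 3 > 0"
      using e(1) assms(5) by linarith+
    with e show ?L
      by blast
  qed auto
  have not0: "\<not> (m mod 3 = 0 \<and> n mod 3 = 0)"
  proof
    assume "m mod 3 = 0 \<and> n mod 3 = 0"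
    then have "3 dvd m" "3 dvd n"
      by presburger+
    then have "is_unit (3 :: int)"
      using assms(4) coprime_common_divisor by blast
    then show False
      by simp
  qed
  have spin: "CR_spin ?K = 1/3 \<longleftrightarrow> monodromy ?K \<noteq> 1"
    by (simp add: CR_spin_def)
  have third: "cis (2 * pi / 3) \<noteq> 1" "cis (4 * pi / 3) \<noteq> 1"
    using Arg2pi_cis[of "2 * pi / 3"] Arg2pi_cis[of "4 * pi / 3"] Arg2pi_cis[of 0] by auto
  have "\<not> 3 dvd n - m \<or> (m mod 3 = 1 \<and> n mod 3 = 1) \<or> (m mod 3 = 2 \<and> n mod 3 = 2)"
    using not0 by presburger
  then consider "\<not> 3 dvd n - m" | "m mod 3 = 1" "n mod 3 = 1" | "m mod 3 = 2" "n mod 3 = 2"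
    by blast
  then show ?thesis
  proof cases
    case 1
    then have "monodromy ?K = 1"
      using mon by simp
    moreover have "\<not> (m mod 3 = 1 \<and> n mod 3 = 1)" "\<not> (m mod 3 = 2 \<and> n mod 3 = 2)"
      using 1 by presburger+
    ultimately show ?thesis
      unfolding A B spin by simp
  next
    case 2
    then have "3 dvd n - m"
      by presburger
    \<comment> \<open>The minus sign in the exponent exchanges the residues: \<open>n\<close>
      congruent to 1 gives the angle \<open>4 * pi / 3\<close>.\<close>
    moreover have "- n = 2 + 3 * (- (n div 3) - 1)"
      using 2 by presburger
    from cis_third[OF this] have "cis (2 * pi * of_int (- n) / 3) = cis (4 * pi / 3)"
      by simp
    ultimately have "monodromy ?K = cis (4 * pi / 3)"
      using mon by simp
    then show ?thesis
      unfolding A B spin phase_anomaly_def using 2 third by (simp add: Arg2pi_cis)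
  next
    case 3
    then have "3 dvd n - m"
      by presburger
    moreover have "- n = 1 + 3 * (- (n div 3) - 1)"
      using 3 by presburger
    from cis_third[OF this] have "cis (2 * pi * of_int (- n) / 3) = cis (2 * pi / 3)"
      by simp
    ultimately have "monodromy ?K = cis (2 * pi / 3)"
      using mon by simp
    then show ?thesis
      unfolding A B spin phase_anomaly_def using 3 third by (simp add: Arg2pi_cis)
  qed
qed

end
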